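(* Assume (H1)–(H4) as described in the context, and let $\mu$ be the Borel measure on $\mathbb{R}^4$ defined by $\mu(E)=\int_{V_1^{c,d}}\chi_E(x,\varphi(x))\,dx$, with Fourier transform $$\widehat{\mu}(\xi',\xi'')=\int_{V_1^{c,d}} e^{-i(\langle x,\xi'\rangle+\langle\varphi(x),\xi''\rangle)}\,dx,\qquad \xi',\xi''\in\mathbb{R}^2.$$ Then there exists a constant $C>0$ such that $$|\widehat{\mu}(\xi',\xi'')|\le C\,|\xi''|^{-\frac{\alpha_1+\alpha_2}{m}}\quad\text{for all }\xi'\in\mathbb{R}^2\text{ and all }\xi''\in\mathbb{R}^2\setminus\{\mathbf 0\}.$$
   Context: Fix $\alpha_1,\alpha_2>0$ with $\alpha_1\neq\alpha_2$. For $t>0$ and $x=(x_1,x_2)\in\mathbb{R}^2$ put $t\bullet x=(t^{\alpha_1}x_1,t^{\alpha_2}x_2)$. For reals $a<b$ let $V^{a,b}=\{t\bullet(1,s): a<s<b,\ t>0\}$, and for $a<c<d<b$ let $V^{c,d}=\{t\bullet(1,s):c<s<d,\ t>0\}$ and $V_1^{c,d}=\{t\bullet(1,s): c<s<d,\ 0<t<1\}$. Let $\varphi=(\varphi_1,\varphi_2):V^{a,b}\to\mathbb{R}^2$. For $x\in V^{a,b}$ let $\varphi_j''(x)$ be the Hessian matrix of $\varphi_j$ at $x$, let $Q_x(\zeta)=\det(\zeta_1\varphi_1''(x)+\zeta_2\varphi_2''(x))$ for $\zeta=(\zeta_1,\zeta_2)\in\mathbb{R}^2$, and let $K(x)$ be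 the symmetric $2\times 2$ matrix with $Q_x(\zeta)=\langle K(x)\zeta,\zeta\rangle$. A point $x$ is elliptic for $\varphi$ if $\min_{\zeta\in S^1}|Q_x(\zeta)|>0$. Assumptions: (H1) $\varphi$ is real analytic on $V^{a,b}$. (H2) For some $m\ge 3(\alpha_1+\alpha_2)$, $\varphi(t\bullet x)=t^m\varphi(x)$ for all $x\in V^{a,b}$, $t>0$. (H3) $a<c<d<b$ and $\sigma\in[c,d]$ are such that the set of nonelliptic points of $\varphi$ in $\overline{V^{c,d}}\setminus\{\mathbf 0\}$ is exactly the curve $\{t\bullet(1,\sigma):t>0\}$. (H4) With $\beta=2(m-\alpha_1-\alpha_2)$, there are positive integers $n_1,n_2$ and constants $D>0$, $\delta>0$ such that: if $\sigma\in(c,d]$ then $\min_{\zeta\in S^1}|Q_{t\bullet(1,s)}(\zeta)|\ge D\,t^\beta|s-\sigma|^{n_1}$ for all $s\in(\sigma-\delta,\sigma)$, $t>0$; if $\sigma\in[c,d)$ then $\min_{\zeta\in S^1}|Q_{t\bullet(1,s)}(\zeta)|\ge D\,t^\beta|s-\sigma|^{n_2}$ for all $s\in(\sigma,\sigma+\delta)$, $t>0$; and $\max\{n_1,n_2\}<\frac{2m}{\alpha_1+\alpha_2}-3$. *)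

theory Defs
  imports "HOL-Analysis.Analysis"
begin

definition dil :: "real \<Rightarrow> real \<Rightarrow> real \<Rightarrow> real \<times> real \<Rightarrow> real \<times> real" where
  "dil a1 a2 t x = (t powr a1 * fst x, t powr a2 * snd x)"

definition cone :: "real \<Rightarrow> real \<Rightarrow> real \<Rightarrow> real \<Rightarrow> (real \<times> real) set" where
  "cone a1 a2 a b = {dil a1 a2 t (1, s) | t s. a < s \<and> s < b \<and> 0 < t}"

definition cone1 :: "real \<Rightarrow> real \<Rightarrow> real \<Rightarrow> real \<Rightarrow> (real \<times> real) set" where
  "cone1 a1 a2 c d = {dil a1 a2 t (1, s) | t s. c < s \<and> s < d \<and> 0 < t \<and> t < 1}"

definition real_analytic2_on :: "(real \<times> real \<Rightarrow> real) \<Rightarrow> (real \<times> real) set \<Rightarrow> bool" where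
  "real_analytic2_on f U \<longleftrightarrow>
     (\<forall>x\<in>U. \<exists>r>0. \<exists>c :: nat \<times> nat \<Rightarrow> real. \<forall>y\<in>ball x r.
        ((\<lambda>(i,j). c (i,j) * (fst y - fst x) ^ i * (snd y - snd x) ^ j) has_sum f y) UNIV)"

definition pd1 :: "(real \<times> real \<Rightarrow> real) \<Rightarrow> real \<times> real \<Rightarrow> real" where
  "pd1 f x = deriv (\<lambda>t. f (t, snd x)) (fst x)"

definition pd2 :: "(real \<times> real \<Rightarrow> real) \<Rightarrow> real \<times> real \<Rightarrow> real" where
  "pd2 f x = deriv (\<lambda>t. f (fst x, t)) (snd x)"

text \<open>Q_x(zeta) = det(zeta_1 phi_1''(x) + zeta_2 phi_2''(x)), the determinant of a 2x2 matrix written out.\<close>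
definition Qform :: "(real \<times> real \<Rightarrow> real \<times> real) \<Rightarrow> real \<times> real \<Rightarrow> real \<times> real \<Rightarrow> real" where
  "Qform \<phi> x \<zeta> =
     (let f1 = (\<lambda>y. fst (\<phi> y)); f2 = (\<lambda>y. snd (\<phi> y));
          h11 = fst \<zeta> * pd1 (pd1 f1) x + snd \<zeta> * pd1 (pd1 f2) x;
          h12 = fst \<zeta> * pd2 (pd1 f1) x + snd \<zeta> * pd2 (pd1 f2) x;
          h21 = fst \<zeta> * pd1 (pd2 f1) x + snd \<zeta> * pd1 (pd2 f2) x;
          h22 = fst \<zeta> * pd2 (pd2 f1) x + snd \<zeta> * pd2 (pd2 f2) x
      in h11 * h22 - h12 * h21)"

definition elliptic :: "(real \<times> real \<Rightarrow> real \<times> real) \<Rightarrow> real \<times> real \<Rightarrow> bool" where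
  "elliptic \<phi> x \<longleftrightarrow> (INF \<zeta>\<in>sphere 0 1. \<bar>Qform \<phi> x \<zeta>\<bar>) > 0"

definition mu_hat :: "real \<Rightarrow> real \<Rightarrow> real \<Rightarrow> real \<Rightarrow> (real \<times> real \<Rightarrow> real \<times> real)
    \<Rightarrow> real \<times> real \<Rightarrow> real \<times> real \<Rightarrow> complex" where
  "mu_hat a1 a2 c d \<phi> \<xi>1 \<xi>2 =
     set_lebesgue_integral lborel (cone1 a1 a2 c d)
       (\<lambda>x. exp (- \<i> * complex_of_real (inner x \<xi>1 + inner (\<phi> x) \<xi>2)))"

end

theory Submission
  imports Defs
begin

text \<open>
  Split off the part 1/2 \<open>\<le>\<close> t < 1 of the domain. The dilation by 1/2 maps the whole domain onto the rest, so
  it suffices that the integral over this fixed piece A decays faster than the claimed rate.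

  On A no stationary phase is needed: with p the least integer with \<open>p \<ge> m / (\<alpha>1 + \<alpha>2)\<close>, at every point of
  the closure of A and for every unit vector \<open>\<zeta>\<close> the function \<open>\<zeta> \<bullet> \<phi>\<close> has a nonzero derivative of some
  order k with 2 \<open>\<le>\<close> k < p in one of the directions (0, 1), (e, 1), (2e, 1). This is clear
  if its Hessian is nonzero, in particular at elliptic points. Otherwise Euler's relation shows that the
  function vanishes to second order in \<open>x2\<close>; if it vanished to order p, its Hessian determinant would be of
  order at least 2p - 3 in the distance to the degenerate curve, contradicting (H4). By compactness the
  derivatives are uniformly bounded below on small boxes, and van der Corput's lemma on parallel segments
  gives the decay \<open>|\<xi>2| powr (- 1 / (p - 1))\<close>, uniformly in \<open>\<xi>1\<close> because linear terms do not affect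
  derivatives of order at least 2. The number e is small so that the segments meet A in intervals.
\<close>

section \<open>Real analytic functions of two variables\<close>

text \<open>The order p is squeezed from two sides. The dyadic recursion needs 1/(p - 1) strictly
  larger than (\<alpha>1 + \<alpha>2)/m, that is p - 1 < m/(\<alpha>1 + \<alpha>2). The
  contradiction with (H4) needs 2p - 3 > max n1 n2, which follows once p \<ge> m/(\<alpha>1 +
  \<alpha>2). The least such integer satisfies both, also when the quotient is an integer, and m
  \<ge> 3(\<alpha>1 + \<alpha>2) gives p \<ge> 3, so that order 2 is always available.

  The number 2p - 3 arises because Euler's relations eliminate all x1-derivatives from the Hessian
  determinant. What remains are products of the phase and its first two x2-derivatives, which vanish
  to orders p, p - 1 and p - 2; the lowest product that occurs has order (p - 1) + (p - 2).

  There are three directions because a quadratic form in two variables has three coefficients. They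
  are nearly vertical because the sector is bounded by graphs over the x1-axis: a sufficiently steep
  line crosses such a graph only upwards.\<close>

definition expands :: "(real \<times> real \<Rightarrow> real) \<Rightarrow> real \<times> real \<Rightarrow> real \<Rightarrow> (nat \<times> nat \<Rightarrow> real) \<Rightarrow> bool" where
  "expands f x \<rho> c \<longleftrightarrow> 0 < \<rho> \<and> (\<lambda>(i,j). \<bar>c (i,j)\<bar> * \<rho> ^ i * \<rho> ^ j) summable_on UNIV \<and>
     (\<forall>h k. \<bar>h\<bar> \<le> \<rho> \<longrightarrow> \<bar>k\<bar> \<le> \<rho> \<longrightarrow>
       ((\<lambda>(i,j). c (i,j) * h ^ i * k ^ j) has_sum f (fst x + h, snd x + k)) UNIV)"

text \<open>\<open>expands\<close> trades the ball for a closed square because there the series at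
  the corner dominates all others: its absolute convergence is the one bound behind the remainder
  estimate, rearrangement and termwise differentiation.\<close>

lemma real_analytic2_onD:
  assumes "real_analytic2_on f U" "x \<in> U"
  obtains \<rho> c where "expands f x \<rho> c"
proof -
  obtain r c where r: "r > 0" and s: "\<And>y. y \<in> ball x r \<Longrightarrow>
        ((\<lambda>(i,j). c (i,j) * (fst y - fst x) ^ i * (snd y - snd x) ^ j) has_sum f y) UNIV"
    using bspec[OF assms(1)[unfolded real_analytic2_on_def] assms(2)] by blast
  \<comment> \<open>With half-side r/3, |h| + |k| is at most 2r/3, so the square lies in the
    ball.\<close>
  define \<rho> where "\<rho> = r / 3"
  have \<rho>: "\<rho> > 0" using r by (simp add: \<rho>_def)
  have sum: "((\<lambda>(i,j). c (i,j) * h ^ i * k ^ j) has_sum f (fst x + h, snd x + k)) UNIV"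
    if "\<bar>h\<bar> \<le> \<rho>" "\<bar>k\<bar> \<le> \<rho>" for h k
  proof -
    have "dist x (fst x + h, snd x + k) \<le> \<bar>h\<bar> + \<bar>k\<bar>"
      using norm_Pair_le[of h k] by (cases x) (simp add: dist_norm norm_minus_commute norm_Pair)
    also have "\<dots> < r" using that r by (simp add: \<rho>_def)
    finally show ?thesis using s[of "(fst x + h, snd x + k)"] by simp
  qed
  have "(\<lambda>(i,j). c (i,j) * \<rho> ^ i * \<rho> ^ j) summable_on UNIV"
    using sum[of \<rho> \<rho>] \<rho> by (auto intro: has_sum_imp_summable)
  \<comment> \<open>\<open>has_sum\<close> is summation without order, so over the reals convergence
    is already absolute.\<close>
  then have "(\<lambda>z. norm ((\<lambda>(i,j). c (i,j) * \<rho> ^ i * \<rho> ^ j) z)) summable_on UNIV"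
    using summable_on_iff_abs_summable_on_real by blast
  also have "(\<lambda>z. norm ((\<lambda>(i,j). c (i,j) * \<rho> ^ i * \<rho> ^ j) z)) = (\<lambda>(i,j). \<bar>c (i,j)\<bar> * \<rho> ^ i * \<rho> ^ j)"
    using \<rho> by (auto simp: abs_mult)
  finally show thesis using that[of \<rho> c] sum \<rho> unfolding expands_def by blast
qed

lemma real_analytic2_onI:
  assumes "\<And>x. x \<in> U \<Longrightarrow> \<exists>\<rho> c. expands f x \<rho> c"
  shows "real_analytic2_on f U"
  unfolding real_analytic2_on_def
proof
  fix x assume "x \<in> U"
  then obtain \<rho> c where e: "expands f x \<rho> c" using assms by blast
  have "((\<lambda>(i,j). c (i,j) * (fst y - fst x) ^ i * (snd y - snd x) ^ j) has_sum f y) UNIV"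
    if "y \<in> ball x \<rho>" for y
  proof -
    have "\<bar>fst y - fst x\<bar> \<le> \<rho>" "\<bar>snd y - snd x\<bar> \<le> \<rho>"
      using that dist_fst_le[of x y] dist_snd_le[of x y] by (auto simp: dist_real_def)
    then have "((\<lambda>(i,j). c (i,j) * (fst y - fst x) ^ i * (snd y - snd x) ^ j) has_sum
        f (fst x + (fst y - fst x), snd x + (snd y - snd x))) UNIV"
      using e unfolding expands_def by blast
    then show ?thesis by simp
  qed
  then show "\<exists>r>0. \<exists>c. \<forall>y\<in>ball x r.
        ((\<lambda>(i,j). c (i,j) * (fst y - fst x) ^ i * (snd y - snd x) ^ j) has_sum f y) UNIV"
    using e unfolding expands_def by blast
qed

lemma real_analytic2_on_add:
  assumes "real_analytic2_on f U" "real_analytic2_on g U"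
  shows "real_analytic2_on (\<lambda>x. f x + g x) U"
  unfolding real_analytic2_on_def
proof
  fix x assume x: "x \<in> U"
  obtain r1 c1 where 1: "r1 > 0" "\<And>y. y \<in> ball x r1 \<Longrightarrow>
        ((\<lambda>(i,j). c1 (i,j) * (fst y - fst x) ^ i * (snd y - snd x) ^ j) has_sum f y) UNIV"
    using bspec[OF assms(1)[unfolded real_analytic2_on_def] x] by blast
  obtain r2 c2 where 2: "r2 > 0" "\<And>y. y \<in> ball x r2 \<Longrightarrow>
        ((\<lambda>(i,j). c2 (i,j) * (fst y - fst x) ^ i * (snd y - snd x) ^ j) has_sum g y) UNIV"
    using bspec[OF assms(2)[unfolded real_analytic2_on_def] x] by blast
  show "\<exists>r>0. \<exists>c. \<forall>y\<in>ball x r.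
        ((\<lambda>(i,j). c (i,j) * (fst y - fst x) ^ i * (snd y - snd x) ^ j) has_sum f y + g y) UNIV"
  proof (intro exI[of _ "min r1 r2"] exI[of _ "\<lambda>z. c1 z + c2 z"] conjI ballI)
    show "0 < min r1 r2" using 1 2 by simp
    fix y assume "y \<in> ball x (min r1 r2)"
    then have "y \<in> ball x r1" "y \<in> ball x r2" by auto
    from has_sum_add[OF 1(2)[OF this(1)] 2(2)[OF this(2)]]
    show "((\<lambda>(i,j). (c1 (i,j) + c2 (i,j)) * (fst y - fst x) ^ i * (snd y - snd x) ^ j) has_sum f y + g y) UNIV"
      by (simp add: case_prod_unfold algebra_simps)
  qed
qed

lemma real_analytic2_on_cmult:
  assumes "real_analytic2_on f U"
  shows "real_analytic2_on (\<lambda>x. a * f x) U"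
  unfolding real_analytic2_on_def
proof
  fix x assume x: "x \<in> U"
  obtain r c where 1: "r > 0" "\<And>y. y \<in> ball x r \<Longrightarrow>
        ((\<lambda>(i,j). c (i,j) * (fst y - fst x) ^ i * (snd y - snd x) ^ j) has_sum f y) UNIV"
    using bspec[OF assms(1)[unfolded real_analytic2_on_def] x] by blast
  show "\<exists>r>0. \<exists>c. \<forall>y\<in>ball x r.
        ((\<lambda>(i,j). c (i,j) * (fst y - fst x) ^ i * (snd y - snd x) ^ j) has_sum a * f y) UNIV"
  proof (intro exI[of _ r] exI[of _ "\<lambda>z. a * c z"] conjI ballI)
    fix y assume "y \<in> ball x r"
    from has_sum_cmult_right[OF 1(2)[OF this], of a]
    show "((\<lambda>(i,j). (a * c (i,j)) * (fst y - fst x) ^ i * (snd y - snd x) ^ j) has_sum a * f y) UNIV"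
      by (simp add: case_prod_unfold algebra_simps)
  qed (use 1 in auto)
qed

text \<open>Every term of total degree at least two contains two factors h or k. A factor
  (|v|/\<rho>)^2 can be pulled out of each, and what is left is majorised by the corner series; the
  remainder is O(|v|^2).\<close>

lemma expands_has_derivative:
  assumes "expands f x \<rho> c"
  shows "(f has_derivative (\<lambda>v. c (1,0) * fst v + c (0,1) * snd v)) (at x)"
proof -
  have \<rho>: "\<rho> > 0" and abs: "(\<lambda>(i,j). \<bar>c (i,j)\<bar> * \<rho> ^ i * \<rho> ^ j) summable_on UNIV"
    and hs: "\<And>h k. \<bar>h\<bar> \<le> \<rho> \<Longrightarrow> \<bar>k\<bar> \<le> \<rho> \<Longrightarrow>
       ((\<lambda>(i,j). c (i,j) * h ^ i * k ^ j) has_sum f (fst x + h, snd x + k)) UNIV"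
    using assms unfolding expands_def by blast+
  define M where "M = infsum (\<lambda>(i,j). \<bar>c (i,j)\<bar> * \<rho> ^ i * \<rho> ^ j) UNIV"
  have M: "((\<lambda>(i,j). \<bar>c (i,j)\<bar> * \<rho> ^ i * \<rho> ^ j) has_sum M) UNIV"
    using abs M_def by simp
  have f0: "f x = c (0,0)"
  proof -
    have "((\<lambda>(i,j). c (i,j) * 0 ^ i * 0 ^ j) has_sum f x) UNIV" using hs[of 0 0] \<rho> by simp
    moreover have "((\<lambda>(i,j). c (i,j) * 0 ^ i * 0 ^ j) has_sum c (0,0)) UNIV"
      by (rule has_sum_finite_neutralI[of "{(0,0)}"]) (auto simp: zero_power2 power_0_left split: if_splits)
    ultimately show ?thesis by (rule has_sum_unique)
  qed
  have R: "\<bar>f (x + v) - f x - (c (1,0) * fst v + c (0,1) * snd v)\<bar> \<le> M / \<rho>\<^sup>2 * (norm v)\<^sup>2"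
    if v: "norm v \<le> \<rho>" for v
  proof -
    obtain h k where vk: "v = (h,k)" by (cases v)
    define \<tau> where "\<tau> = norm v"
    have hk: "\<bar>h\<bar> \<le> \<tau>" "\<bar>k\<bar> \<le> \<tau>" "0 \<le> \<tau>" "\<tau> \<le> \<rho>"
      using norm_fst_le[of h k] norm_snd_le[of k h] v by (auto simp: \<tau>_def vk)
    let ?S = "{(0,0),(1,0),(0,1)} :: (nat\<times>nat) set"
    define g where "g = (\<lambda>(i,j). c (i,j) * h ^ i * k ^ j)"
    have "(g has_sum f (x + v)) UNIV" using hs[of h k] hk by (simp add: g_def vk plus_prod_def)
    moreover have "(g has_sum sum g ?S) ?S" by (rule has_sum_finite) simp
    ultimately have "(g has_sum f (x + v) - sum g ?S) (UNIV - ?S)"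
      by (rule has_sum_Diff) auto
    moreover have "sum g ?S = f x + (c (1,0) * fst v + c (0,1) * snd v)"
      by (simp add: g_def f0 vk)
    ultimately have g1: "(g has_sum f (x + v) - f x - (c (1,0) * fst v + c (0,1) * snd v)) (UNIV - ?S)"
      by (simp add: algebra_simps)
    define G where "G = (\<lambda>z. (\<tau>/\<rho>)\<^sup>2 * (\<lambda>(i,j). \<bar>c (i,j)\<bar> * \<rho> ^ i * \<rho> ^ j) z)"
    have G: "(G has_sum (\<tau>/\<rho>)\<^sup>2 * M) UNIV"
      unfolding G_def by (rule has_sum_cmult_right[OF M])
    have Gs: "(G has_sum infsum G (UNIV - ?S)) (UNIV - ?S)"
      using summable_on_subset_banach[OF has_sum_imp_summable[OF G]] by (intro has_sum_infsum) auto
    have G0: "G z \<ge> 0" for z using \<rho> by (auto simp: G_def case_prod_unfold)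
    have le: "infsum G (UNIV - ?S) \<le> (\<tau>/\<rho>)\<^sup>2 * M"
      by (rule has_sum_mono2[OF Gs G]) (use G0 in auto)
    have gG: "\<bar>g z\<bar> \<le> G z" if "z \<in> UNIV - ?S" for z
    proof -
      obtain i j where z: "z = (i,j)" by (cases z)
      have "(i = 0 \<and> j = 0) \<or> (i = 1 \<and> j = 0) \<or> (i = 0 \<and> j = 1) \<or> i + j \<ge> 2" by arith
      then have ij: "i + j \<ge> 2" using that by (auto simp: z)
      have "\<bar>h\<bar>^i * \<bar>k\<bar>^j \<le> \<tau>^i * \<tau>^j"
        by (intro mult_mono power_mono) (use hk in auto)
      also have "\<dots> = \<tau>\<^sup>2 * \<tau>^(i+j-2)" using ij by (metis le_add_diff_inverse power_add)
      also have "\<dots> \<le> \<tau>\<^sup>2 * \<rho>^(i+j-2)" by (intro mult_left_mono power_mono) (use hk in auto)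
      also have "\<dots> = (\<tau>/\<rho>)\<^sup>2 * (\<rho>\<^sup>2 * \<rho>^(i+j-2))" using \<rho> by (simp add: power_divide)
      also have "\<rho>\<^sup>2 * \<rho>^(i+j-2) = \<rho>^i * \<rho>^j" using ij by (metis le_add_diff_inverse power_add)
      finally have "\<bar>c (i,j)\<bar> * (\<bar>h\<bar>^i * \<bar>k\<bar>^j) \<le> \<bar>c (i,j)\<bar> * ((\<tau>/\<rho>)\<^sup>2 * (\<rho>^i * \<rho>^j))"
        by (rule mult_left_mono) simp
      then show ?thesis by (simp add: z g_def G_def abs_mult power_abs mult_ac)
    qed
    have "norm (f (x + v) - f x - (c (1,0) * fst v + c (0,1) * snd v)) \<le> infsum G (UNIV - ?S)"
      by (rule norm_infsum_le[OF g1 Gs]) (simp only: real_norm_def gG)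
    then show ?thesis using le by (simp add: \<tau>_def power_divide mult.commute)
  qed
  show ?thesis
    unfolding has_derivative_at
  proof
    show "bounded_linear (\<lambda>v. c (1,0) * fst v + c (0,1) * snd v)"
      by (intro bounded_linear_add bounded_linear_const_mult bounded_linear_fst bounded_linear_snd)
    show "(\<lambda>v. norm (f (x + v) - f x - (c (1,0) * fst v + c (0,1) * snd v)) / norm v) \<midarrow>0\<rightarrow> 0"
    proof (rule Lim_null_comparison)
      show "\<forall>\<^sub>F v in at 0. norm (norm (f (x + v) - f x - (c (1,0) * fst v + c (0,1) * snd v)) / norm v) \<le> M / \<rho>\<^sup>2 * norm v"
        unfolding eventually_at
      proof (intro exI[of _ \<rho>] conjI ballI impI)
        fix v :: "real \<times> real" assume "v \<noteq> 0 \<and> dist v 0 < \<rho>"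
        then show "norm (norm (f (x + v) - f x - (c (1,0) * fst v + c (0,1) * snd v)) / norm v) \<le> M / \<rho>\<^sup>2 * norm v"
          using R[of v] by (simp add: divide_le_eq power2_eq_square mult_ac)
      qed (rule \<rho>)
      show "((\<lambda>v. M / \<rho>\<^sup>2 * norm v) \<longlongrightarrow> 0) (at 0)"
        by (rule tendsto_eq_intros refl | simp)+
    qed
  qed
qed

lemma expands_pd:
  assumes "expands f x \<rho> c"
  shows "pd1 f x = c (1,0)" "pd2 f x = c (0,1)"
proof -
  have d: "(f has_derivative (\<lambda>v. c (1,0) * fst v + c (0,1) * snd v)) (at (fst x, snd x))"
    using expands_has_derivative[OF assms] by simp
  have "((\<lambda>t. f (t, snd x)) has_derivative (\<lambda>t. c (1,0) * t)) (at (fst x))"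
    by (rule has_derivative_compose[where f = "\<lambda>t. (t, snd x)" and g = f, OF _ d, THEN has_derivative_eq_rhs])
       (auto intro!: derivative_eq_intros)
  then show "pd1 f x = c (1,0)"
    unfolding pd1_def by (intro DERIV_imp_deriv) (simp add: has_field_derivative_def)
  have "((\<lambda>t. f (fst x, t)) has_derivative (\<lambda>t. c (0,1) * t)) (at (snd x))"
    by (rule has_derivative_compose[where f = "\<lambda>t. (fst x, t)" and g = f, OF _ d, THEN has_derivative_eq_rhs])
       (auto intro!: derivative_eq_intros)
  then show "pd2 f x = c (0,1)"
    unfolding pd2_def by (intro DERIV_imp_deriv) (simp add: has_field_derivative_def)
qed

text \<open>Halving the square pays for the factor i + 1 from differentiation, as i + 1 \<le> 2^i.
  The derivative is computed by summing over j at fixed k, which leaves an ordinary power series in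
  h; absolute convergence identifies the differentiated iterated sum with the double one.\<close>

lemma expands_pd1:
  assumes "expands f x \<rho> c"
  shows "expands (pd1 f) x (\<rho> / 2) (\<lambda>(i,j). real (Suc i) * c (Suc i, j))"
proof -
  have \<rho>: "\<rho> > 0" and abs: "(\<lambda>(i,j). \<bar>c (i,j)\<bar> * \<rho> ^ i * \<rho> ^ j) summable_on UNIV"
    and hs: "\<And>h k. \<bar>h\<bar> \<le> \<rho> \<Longrightarrow> \<bar>k\<bar> \<le> \<rho> \<Longrightarrow>
       ((\<lambda>(i,j). c (i,j) * h ^ i * k ^ j) has_sum f (fst x + h, snd x + k)) UNIV"
    using assms unfolding expands_def by blast+
  let ?c = "\<lambda>(i,j). real (Suc i) * c (Suc i, j)"
  have "inj (map_prod Suc (id :: nat \<Rightarrow> nat))" by (simp add: prod.inj_map)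
  moreover have "(\<lambda>(i,j). \<bar>c (i,j)\<bar> * \<rho> ^ i * \<rho> ^ j) summable_on range (map_prod Suc id)"
    by (rule summable_on_subset_banach[OF abs]) simp
  ultimately have "(\<lambda>(i,j). \<bar>c (Suc i,j)\<bar> * \<rho> ^ Suc i * \<rho> ^ j) summable_on UNIV"
    by (subst (asm) summable_on_reindex) (auto simp: o_def case_prod_unfold map_prod_def)
  from summable_on_cmult_right[OF this, of "1 / \<rho>"]
  have sh: "(\<lambda>(i,j). \<bar>c (Suc i,j)\<bar> * \<rho> ^ i * \<rho> ^ j) summable_on UNIV"
    using \<rho> by (simp add: case_prod_unfold mult.assoc)
  have bound: "\<bar>?c z * h ^ fst z * k ^ snd z\<bar> \<le> (\<lambda>(i,j). \<bar>c (Suc i,j)\<bar> * \<rho> ^ i * \<rho> ^ j) z"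
    if "\<bar>h\<bar> \<le> \<rho>/2" "\<bar>k\<bar> \<le> \<rho>/2" for h k z
  proof -
    obtain i j where z: "z = (i,j)" by (cases z)
    have "real (Suc i) \<le> 2 ^ i"
      by (induction i) auto
    moreover have "\<bar>h\<bar> ^ i \<le> (\<rho>/2) ^ i" by (rule power_mono) (use that in auto)
    moreover have "\<bar>k\<bar> ^ j \<le> \<rho> ^ j" by (rule power_mono) (use that \<rho> in auto)
    ultimately have "real (Suc i) * \<bar>h\<bar> ^ i * \<bar>k\<bar> ^ j \<le> 2 ^ i * (\<rho>/2) ^ i * \<rho> ^ j"
      using \<rho> by (intro mult_mono) auto
    also have "\<dots> = \<rho> ^ i * \<rho> ^ j" using \<rho> by (simp add: power_divide)
    finally have "\<bar>c (Suc i, j)\<bar> * (real (Suc i) * \<bar>h\<bar> ^ i * \<bar>k\<bar> ^ j) \<le> \<bar>c (Suc i, j)\<bar> * (\<rho> ^ i * \<rho> ^ j)"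
      by (rule mult_left_mono) simp
    then show ?thesis by (simp add: z abs_mult power_abs mult_ac)
  qed
  have abs': "(\<lambda>z. \<bar>?c z * h ^ fst z * k ^ snd z\<bar>) summable_on UNIV"
    if "\<bar>h\<bar> \<le> \<rho>/2" "\<bar>k\<bar> \<le> \<rho>/2" for h k
    by (rule summable_on_comparison_test[OF sh]) (use bound[OF that] in auto)
  have "((\<lambda>(i,j). ?c (i,j) * h ^ i * k ^ j) has_sum pd1 f (fst x + h, snd x + k)) UNIV"
    if hk: "\<bar>h\<bar> \<le> \<rho>/2" "\<bar>k\<bar> \<le> \<rho>/2" for h k
  proof -
    have k: "\<bar>k\<bar> \<le> \<rho>" using hk \<rho> by simp
    define a where "a i = infsum (\<lambda>j. c (i,j) * k ^ j) UNIV" for i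
    \<comment> \<open>Convergence of row i is read off at h = \<rho>, where the common factor
      \<rho>^i can be divided out.\<close>
    have a: "((\<lambda>j. c (i,j) * k ^ j) has_sum a i) UNIV" for i
    proof -
      have "(\<lambda>(i,j). c (i,j) * \<rho> ^ i * k ^ j) summable_on (SIGMA i:UNIV. UNIV)"
        using has_sum_imp_summable[OF hs[of \<rho> k]] k \<rho> by simp
      from summable_on_SigmaD1[OF this, of i]
      have "(\<lambda>j. \<rho> ^ i * (c (i,j) * k ^ j)) summable_on UNIV" by (simp add: mult_ac)
      then have "(\<lambda>j. c (i,j) * k ^ j) summable_on UNIV"
        using \<rho> by (subst (asm) summable_on_cmult_right') auto
      then show ?thesis unfolding a_def by simp
    qed
    have s1: "(\<lambda>i. a i * h' ^ i) sums f (fst x + h', snd x + k)" if "\<bar>h'\<bar> \<le> \<rho>" for h'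
    proof (rule has_sum_imp_sums, rule has_sum_SigmaD[where B = "\<lambda>_. UNIV"])
      show "((\<lambda>(i,j). c (i,j) * h' ^ i * k ^ j) has_sum f (fst x + h', snd x + k)) (UNIV \<times> UNIV)"
        using hs[OF that k] by simp
      show "((\<lambda>j. (\<lambda>(i,j). c (i,j) * h' ^ i * k ^ j) (i, j)) has_sum a i * h' ^ i) UNIV" for i
        using has_sum_cmult_left[OF a[of i], of "h' ^ i"] by (simp add: mult_ac)
    qed
    have "summable (\<lambda>i. a i * \<rho> ^ i)" using s1[of \<rho>] \<rho> by (auto simp: sums_iff)
    then have D: "DERIV (\<lambda>h'. \<Sum>i. a i * h' ^ i) h :> (\<Sum>i. diffs a i * h ^ i)"
      by (rule termdiffs_strong) (use hk \<rho> in auto)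
    have "DERIV (\<lambda>h'. f (fst x + h', snd x + k)) h :> (\<Sum>i. diffs a i * h ^ i)"
    proof (rule has_field_derivative_transform_within_open[OF D, of "ball 0 \<rho>"])
      show "h \<in> ball 0 \<rho>" using hk \<rho> by auto
      show "(\<Sum>i. a i * h' ^ i) = f (fst x + h', snd x + k)" if "h' \<in> ball 0 \<rho>" for h'
        using s1[of h'] that by (auto simp: sums_iff)
    qed auto
    then have "DERIV (\<lambda>t. f (t, snd x + k)) (fst x + h) :> (\<Sum>i. diffs a i * h ^ i)"
      using DERIV_shift[of "\<lambda>t. f (t, snd x + k)" _ h "fst x"] by (simp add: add.commute)
    then have p: "pd1 f (fst x + h, snd x + k) = (\<Sum>i. diffs a i * h ^ i)"
      unfolding pd1_def by (simp add: DERIV_imp_deriv)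
    have "(\<lambda>z. norm (?c z * h ^ fst z * k ^ snd z)) summable_on UNIV"
      using abs'[OF hk] by simp
    then have "(\<lambda>z. ?c z * h ^ fst z * k ^ snd z) summable_on UNIV"
      by (rule abs_summable_summable)
    then obtain S where S: "((\<lambda>z. ?c z * h ^ fst z * k ^ snd z) has_sum S) (UNIV \<times> UNIV)"
      unfolding summable_on_def by auto
    have "(\<lambda>i. diffs a i * h ^ i) sums S"
    proof (rule has_sum_imp_sums, rule has_sum_SigmaD[OF S])
      show "((\<lambda>j. ?c (i,j) * h ^ fst (i,j) * k ^ snd (i,j)) has_sum diffs a i * h ^ i) UNIV" for i
        using has_sum_cmult_right[OF a[of "Suc i"], of "real (Suc i) * h ^ i"]
        by (simp add: diffs_def mult_ac)
    qed
    then show ?thesis using S p by (simp add: sums_iff case_prod_unfold)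
  qed
  moreover have "(\<lambda>(i,j). \<bar>?c (i,j)\<bar> * (\<rho>/2) ^ i * (\<rho>/2) ^ j) summable_on UNIV"
    using abs'[of "\<rho>/2" "\<rho>/2"] \<rho> by (simp add: case_prod_unfold abs_mult)
  ultimately show ?thesis using \<rho> unfolding expands_def by auto
qed

lemma expands_swap:
  assumes "expands f x \<rho> c"
  shows "expands (\<lambda>y. f (snd y, fst y)) (snd x, fst x) \<rho> (\<lambda>(i,j). c (j,i))"
proof -
  have \<rho>: "\<rho> > 0" and abs: "(\<lambda>(i,j). \<bar>c (i,j)\<bar> * \<rho> ^ i * \<rho> ^ j) summable_on (UNIV \<times> UNIV)"
    and hs: "\<And>h k. \<bar>h\<bar> \<le> \<rho> \<Longrightarrow> \<bar>k\<bar> \<le> \<rho> \<Longrightarrow>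
       ((\<lambda>(i,j). c (i,j) * h ^ i * k ^ j) has_sum f (fst x + h, snd x + k)) (UNIV \<times> UNIV)"
    using assms unfolding expands_def by auto
  show ?thesis
    unfolding expands_def
  proof (intro conjI allI impI)
    show "(\<lambda>(i,j). \<bar>case (i,j) of (i,j) \<Rightarrow> c (j,i)\<bar> * \<rho> ^ i * \<rho> ^ j) summable_on UNIV"
      using iffD1[OF summable_on_swap abs] by (simp add: case_prod_unfold mult_ac)
    fix h k :: real assume "\<bar>h\<bar> \<le> \<rho>" "\<bar>k\<bar> \<le> \<rho>"
    then show "((\<lambda>(i,j). (case (i,j) of (i,j) \<Rightarrow> c (j,i)) * h ^ i * k ^ j) has_sum
        f (snd (fst (snd x, fst x) + h, snd (snd x, fst x) + k),
           fst (fst (snd x, fst x) + h, snd (snd x, fst x) + k))) UNIV"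
      using iffD1[OF has_sum_swap hs[of k h]] by (simp add: case_prod_unfold mult_ac)
  qed (rule \<rho>)
qed

lemma pd2_eq_pd1_swap: "pd2 f = (\<lambda>y. pd1 (\<lambda>y. f (snd y, fst y)) (snd y, fst y))"
  by (auto simp: pd1_def pd2_def)

lemma expands_pd2:
  assumes "expands f x \<rho> c"
  shows "expands (pd2 f) x (\<rho> / 2) (\<lambda>(i,j). real (Suc j) * c (i, Suc j))"
  using expands_swap[OF expands_pd1[OF expands_swap[OF assms]]]
  by (simp add: pd2_eq_pd1_swap case_prod_unfold)

lemma real_analytic2_on_pd1: "real_analytic2_on f U \<Longrightarrow> real_analytic2_on (pd1 f) U"
  by (rule real_analytic2_onI) (blast elim: real_analytic2_onD dest: expands_pd1)

lemma real_analytic2_on_pd2: "real_analytic2_on f U \<Longrightarrow> real_analytic2_on (pd2 f) U"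
  by (rule real_analytic2_onI) (blast elim: real_analytic2_onD dest: expands_pd2)

lemma real_analytic2_has_derivative:
  assumes "real_analytic2_on f U" "x \<in> U"
  shows "(f has_derivative (\<lambda>v. pd1 f x * fst v + pd2 f x * snd v)) (at x)"
proof -
  obtain \<rho> c where "expands f x \<rho> c" using real_analytic2_onD[OF assms] .
  then show ?thesis using expands_has_derivative expands_pd[of f x \<rho> c] by simp
qed

lemma real_analytic2_pd_commute:
  assumes "real_analytic2_on f U" "x \<in> U"
  shows "pd2 (pd1 f) x = pd1 (pd2 f) x"
proof -
  obtain \<rho> c where e: "expands f x \<rho> c" using real_analytic2_onD[OF assms] .
  show ?thesis
    using expands_pd(2)[OF expands_pd1[OF e]] expands_pd(1)[OF expands_pd2[OF e]] by simp
qed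

lemma real_analytic2_imp_continuous_on:
  "real_analytic2_on f U \<Longrightarrow> continuous_on U f"
  by (auto intro!: continuous_at_imp_continuous_on has_derivative_continuous[OF real_analytic2_has_derivative])

section \<open>Derivatives along lines\<close>

lemma real_analytic2_DERIV_pd1:
  assumes "real_analytic2_on f U" "(x, y) \<in> U"
  shows "((\<lambda>t. f (t, y)) has_real_derivative pd1 f (x, y)) (at x)"
  unfolding has_field_derivative_def
  by (rule has_derivative_compose[where f = "\<lambda>t. (t, y)" and g = f,
        OF _ real_analytic2_has_derivative[OF assms], THEN has_derivative_eq_rhs])
     (auto intro!: derivative_eq_intros)

text \<open>The derivative along (\<epsilon>, 1). Normalising the second component to 1 lets every
  segment be parametrised by its second coordinate, as
  \<open>(y + \<epsilon> * u, u)\<close>.\<close>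

definition Dd :: "real \<Rightarrow> (real \<times> real \<Rightarrow> real) \<Rightarrow> real \<times> real \<Rightarrow> real" where
  "Dd \<epsilon> f x = \<epsilon> * pd1 f x + pd2 f x"

lemma real_analytic2_on_Dd: "real_analytic2_on f U \<Longrightarrow> real_analytic2_on (Dd \<epsilon> f) U"
  unfolding Dd_def[abs_def]
  by (intro real_analytic2_on_add real_analytic2_on_cmult real_analytic2_on_pd1 real_analytic2_on_pd2)

lemma real_analytic2_on_Dd_pow: "real_analytic2_on f U \<Longrightarrow> real_analytic2_on ((Dd \<epsilon> ^^ k) f) U"
  by (induction k) (auto intro: real_analytic2_on_Dd)

lemma real_analytic2_DERIV_Dd:
  assumes "real_analytic2_on f U" "(y + \<epsilon> * u, u) \<in> U"
  shows "((\<lambda>u. f (y + \<epsilon> * u, u)) has_real_derivative Dd \<epsilon> f (y + \<epsilon> * u, u)) (at u)"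
  unfolding has_field_derivative_def Dd_def
  by (rule has_derivative_compose[where f = "\<lambda>u. (y + \<epsilon> * u, u)" and g = f,
        OF _ real_analytic2_has_derivative[OF assms], THEN has_derivative_eq_rhs])
     (auto intro!: derivative_eq_intros simp: algebra_simps)

lemma Dd_0: "Dd 0 = pd2"
  by (simp add: Dd_def fun_eq_iff)

text \<open>This is the Hessian form at (\<epsilon>, 1); it links the vanishing of second
  directional derivatives to the entries of the Hessian.\<close>

lemma Dd_Dd:
  assumes "real_analytic2_on f U" "x \<in> U"
  shows "Dd \<epsilon> (Dd \<epsilon> f) x = \<epsilon>\<^sup>2 * pd1 (pd1 f) x + 2 * \<epsilon> * pd1 (pd2 f) x + pd2 (pd2 f) x"
proof -
  obtain a b where x: "x = (a, b)" by (cases x)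
  have A: "real_analytic2_on (pd1 f) U" "real_analytic2_on (pd2 f) U"
    using assms(1) real_analytic2_on_pd1 real_analytic2_on_pd2 by auto
  have "((\<lambda>t. Dd \<epsilon> f (t, b)) has_real_derivative \<epsilon> * pd1 (pd1 f) x + pd1 (pd2 f) x) (at a)"
    unfolding Dd_def x using assms(2)[unfolded x]
    by (intro DERIV_add DERIV_cmult real_analytic2_DERIV_pd1[where U = U] A)
  then have 1: "pd1 (Dd \<epsilon> f) x = \<epsilon> * pd1 (pd1 f) x + pd1 (pd2 f) x"
    by (simp add: pd1_def x DERIV_imp_deriv)
  have p2: "((\<lambda>t. g (a, t)) has_real_derivative pd2 g (a, b)) (at b)" if "real_analytic2_on g U" for g
    using real_analytic2_DERIV_Dd[of g U a 0 b] that assms(2) by (simp add: Dd_0 x)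
  have "((\<lambda>t. Dd \<epsilon> f (a, t)) has_real_derivative \<epsilon> * pd2 (pd1 f) x + pd2 (pd2 f) x) (at b)"
    unfolding Dd_def x by (intro DERIV_add DERIV_cmult p2 A)
  then have 2: "pd2 (Dd \<epsilon> f) x = \<epsilon> * pd2 (pd1 f) x + pd2 (pd2 f) x"
    by (simp add: pd2_def x DERIV_imp_deriv)
  show ?thesis
    using real_analytic2_pd_commute[OF assms]
    by (simp add: Dd_def[of \<epsilon> "Dd \<epsilon> f"] 1 2 power2_eq_square algebra_simps)
qed

section \<open>Van der Corput's lemma\<close>

text \<open>Integration by parts. The unit number \<open>c\<close> is i or -i, so that a caller can
  make the derivative of the phase positive by moving a sign into \<open>c\<close>. The constant 3
  counts two boundary terms and the variation of 1/F1, which telescopes because F2 has constant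
  sign.\<close>

lemma van_der_Corput_first:
  fixes F0 F1 F2 :: "real \<Rightarrow> real" and c :: complex
  assumes c: "norm c = 1" and c': "Re c = 0"
    and d0: "\<And>u. u \<in> {a..b} \<Longrightarrow> (F0 has_real_derivative F1 u) (at u within {a..b})"
    and d1: "\<And>u. u \<in> {a..b} \<Longrightarrow> (F1 has_real_derivative F2 u) (at u within {a..b})"
    and mu: "0 < \<mu>" "\<And>u. u \<in> {a..b} \<Longrightarrow> \<mu> \<le> F1 u"
    and mono: "(\<forall>u\<in>{a..b}. 0 \<le> F2 u) \<or> (\<forall>u\<in>{a..b}. F2 u \<le> 0)"
  shows "norm (integral {a..b} (\<lambda>u. exp (F0 u *\<^sub>R c))) \<le> 3 / \<mu>"
proof (cases "a < b")
  case True
  obtain \<tau> :: real where \<tau>: "\<bar>\<tau>\<bar> = 1" "\<And>u. u \<in> {a..b} \<Longrightarrow> 0 \<le> \<tau> * F2 u"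
    using mono that[of 1] that[of "-1"] by (auto simp del: atLeastAtMost_iff)
  define e where "e = (\<lambda>u. exp (F0 u *\<^sub>R c))"
  have ne: "norm (e u) = 1" for u
    using c' by (simp add: e_def)
  have cF: "continuous_on {a..b} F0" "continuous_on {a..b} F1"
    using d0 d1 by (meson DERIV_continuous continuous_on_eq_continuous_within)+
  have ce: "continuous_on {a..b} e"
    unfolding e_def by (intro continuous_intros cF)
  have F1pos: "0 < F1 u" if "u \<in> {a..b}" for u using mu that by force
  \<comment> \<open>\<open>W\<close> is the integral minus its boundary term, so only the derivative
    of 1/F1 survives in its derivative. Up to the sign \<tau> the norm of that is an exact
    derivative, and \<open>- \<tau> / F1\<close> serves as comparison function in the mean value
    inequality.\<close>
  define W where "W = (\<lambda>u. integral {a..u} e - (1 / F1 u) *\<^sub>R (e u / c))"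
  have c0: "c \<noteq> 0" using c by auto
  have "norm (W b - W a) \<le> - \<tau> / F1 b - (- \<tau> / F1 a)"
  proof (rule differentiable_bound_general[OF True])
    show "continuous_on {a..b} W"
      unfolding W_def
      by (intro continuous_intros cF ce indefinite_integral_continuous_1 integrable_continuous_interval)
         (use F1pos c0 in \<open>force+\<close>)
    show "continuous_on {a..b} (\<lambda>u. - \<tau> / F1 u)"
      by (intro continuous_intros cF) (use F1pos in force)
    fix u assume u: "a < u" "u < b"
    then have at: "at u within {a..b} = at u" by (simp add: at_within_Icc_at)
    have uab: "u \<in> {a..b}" using u by simp
    have D0: "(F0 has_real_derivative F1 u) (at u)" and D1: "(F1 has_real_derivative F2 u) (at u)"
      using d0[OF uab] d1[OF uab] by (simp_all add: at)
    show "((\<lambda>u. - \<tau> / F1 u) has_vector_derivative \<tau> * F2 u / (F1 u)\<^sup>2) (at u)"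
      unfolding has_real_derivative_iff_has_vector_derivative[symmetric]
      by (rule derivative_eq_intros D1 refl | use F1pos[OF uab] in \<open>simp add: power2_eq_square\<close>)+
    have "((\<lambda>u. F0 u *\<^sub>R c) has_vector_derivative F1 u *\<^sub>R c) (at u)"
      using has_vector_derivative_scaleR[OF D0 has_vector_derivative_const[of c]] by simp
    from field_vector_diff_chain_at[OF this DERIV_exp]
    have De: "(e has_vector_derivative F1 u *\<^sub>R c * e u) (at u)"
      by (simp add: e_def o_def)
    have Di: "((\<lambda>u. 1 / F1 u) has_real_derivative - F2 u / (F1 u)\<^sup>2) (at u)"
      by (rule derivative_eq_intros D1 refl | use F1pos[OF uab] in \<open>simp add: power2_eq_square\<close>)+
    have Dc: "((\<lambda>u. e u / c) has_vector_derivative F1 u *\<^sub>R e u) (at u)"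
      using bounded_linear.has_vector_derivative[OF bounded_linear_divide[of c] De] c0 by (simp add: scaleR_conv_of_real)
    have I: "((\<lambda>u. integral {a..u} e) has_vector_derivative e u) (at u)"
      using integral_has_vector_derivative[OF ce uab] by (simp add: at)
    have "(W has_vector_derivative e u - ((1 / F1 u) *\<^sub>R (F1 u *\<^sub>R e u) + (- F2 u / (F1 u)\<^sup>2) *\<^sub>R (e u / c))) (at u)"
      unfolding W_def by (intro has_vector_derivative_diff I has_vector_derivative_scaleR Di Dc)
    then show "(W has_vector_derivative (F2 u / (F1 u)\<^sup>2) *\<^sub>R (e u / c)) (at u)"
      using F1pos[OF uab] by simp
    have "\<bar>F2 u\<bar> = \<tau> * F2 u" using \<tau>(2)[OF uab] \<tau>(1) by (auto simp: abs_if split: if_splits)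
    then show "norm ((F2 u / (F1 u)\<^sup>2) *\<^sub>R (e u / c)) \<le> \<tau> * F2 u / (F1 u)\<^sup>2"
      by (simp add: norm_divide ne c)
  qed
  moreover have "\<bar>\<tau> / F1 b\<bar> \<le> 1 / \<mu>" "\<bar>\<tau> / F1 a\<bar> \<le> 1 / \<mu>" "\<bar>1 / F1 b\<bar> \<le> 1 / \<mu>" "\<bar>1 / F1 a\<bar> \<le> 1 / \<mu>"
    using \<tau>(1) F1pos[of a] F1pos[of b] mu True by (auto simp: abs_divide frac_le)
  \<comment> \<open>Up to sign a difference of two numbers in (0, 1/\<mu>], hence at most 1/\<mu>
    and not merely 2/\<mu>.\<close>
  moreover have "- \<tau> / F1 b - (- \<tau> / F1 a) \<le> 1 / \<mu>"
  proof -
    have "0 < 1 / F1 a" "0 < 1 / F1 b" "1 / F1 a \<le> 1 / \<mu>" "1 / F1 b \<le> 1 / \<mu>"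
      using F1pos[of a] F1pos[of b] mu True by (auto simp: frac_le)
    moreover have "\<tau> = 1 \<or> \<tau> = -1" using \<tau>(1) by auto
    ultimately show ?thesis by (elim disjE; simp only: minus_divide_left[symmetric]; linarith)
  qed
  ultimately have "norm (W b - W a) \<le> 1 / \<mu>" by linarith
  moreover have "integral {a..b} e = (W b - W a) + (1 / F1 b) *\<^sub>R (e b / c) - (1 / F1 a) *\<^sub>R (e a / c)"
    by (simp add: W_def)
  moreover have "norm ((1 / F1 b) *\<^sub>R (e b / c)) \<le> 1 / \<mu>" "norm ((1 / F1 a) *\<^sub>R (e a / c)) \<le> 1 / \<mu>"
    using mu True F1pos[of a] F1pos[of b] by (auto simp: norm_divide ne c frac_le)
  ultimately have "norm (integral {a..b} e) \<le> 1 / \<mu> + 1 / \<mu> + 1 / \<mu>"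
    by (smt (verit) norm_triangle_ineq norm_triangle_ineq4)
  then show ?thesis by (simp add: e_def)
next
  case False
  then have "integral {a..b} (\<lambda>u. exp (F0 u *\<^sub>R c)) = 0" by (cases "a = b") auto
  then show ?thesis using mu by (simp del: atLeastAtMost_iff)
qed

text \<open>The passage from one order to the next, with an abstract integrand: a function
  \<open>G\<close> of slope at least \<mu> can be smaller than \<open>\<mu> * \<delta>\<close> in
  modulus only within \<delta> of one point. This window costs 2\<delta>, and on each flank the
  bound \<open>B\<close> of the preceding order applies.\<close>

lemma van_der_Corput_split:
  fixes G G' :: "real \<Rightarrow> real" and e :: "real \<Rightarrow> complex"
  assumes dG: "\<And>u. u \<in> {a..b} \<Longrightarrow> (G has_real_derivative G' u) (at u within {a..b})"
    and mu: "0 < \<mu>" "\<And>u. u \<in> {a..b} \<Longrightarrow> \<mu> \<le> G' u" and \<delta>: "0 < \<delta>"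
    and e: "continuous_on {a..b} e" "\<And>u. norm (e u) \<le> 1" and B: "0 \<le> B"
    and pos: "\<And>a' b'. {a'..b'} \<subseteq> {a..b} \<Longrightarrow> (\<And>u. u \<in> {a'..b'} \<Longrightarrow> \<mu> * \<delta> \<le> G u) \<Longrightarrow>
        norm (integral {a'..b'} e) \<le> B"
    and neg: "\<And>a' b'. {a'..b'} \<subseteq> {a..b} \<Longrightarrow> (\<And>u. u \<in> {a'..b'} \<Longrightarrow> G u \<le> - (\<mu> * \<delta>)) \<Longrightarrow>
        norm (integral {a'..b'} e) \<le> B"
  shows "norm (integral {a..b} e) \<le> 2 * \<delta> + 2 * B"
proof (cases "a \<le> b")
  case True
  have cG: "continuous_on {a..b} G"
    using dG by (meson DERIV_continuous continuous_on_eq_continuous_within)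
  have inc: "G v - G u \<ge> \<mu> * (v - u)" if "a \<le> u" "u \<le> v" "v \<le> b" for u v
  proof (cases "u < v")
    case True
    have "(G has_derivative (\<lambda>h. G' x * h)) (at x within {u..v})" if "u \<le> x" "x \<le> v" for x
      using has_derivative_subset[OF dG[of x, unfolded has_field_derivative_def], of "{u..v}"]
        that \<open>a \<le> u\<close> \<open>v \<le> b\<close> by auto
    from mvt_simple[OF True this]
    obtain x where "x \<in> {u<..<v}" "G v - G u = G' x * (v - u)" by auto
    then show ?thesis using mu(2)[of x] that True by (auto intro!: mult_right_mono)
  qed (use that in auto)
  \<comment> \<open>The zero of \<open>G\<close>, or an endpoint if \<open>G\<close> keeps one sign;
    the inequality on the empty side then holds vacuously.\<close>
  obtain z where z: "a \<le> z" "z \<le> b"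
    and zp: "\<And>u. z < u \<Longrightarrow> u \<le> b \<Longrightarrow> \<mu> * (u - z) \<le> G u"
    and zn: "\<And>u. a \<le> u \<Longrightarrow> u < z \<Longrightarrow> G u \<le> - (\<mu> * (z - u))"
  proof -
    consider "0 \<le> G a" | "G b \<le> 0" | "G a \<le> 0" "0 \<le> G b" by linarith
    then show thesis
    proof cases
      case 1
      show thesis
      proof (rule that[of a])
        show "\<mu> * (u - a) \<le> G u" if "a < u" "u \<le> b" for u
          using inc[of a u] that 1 True by linarith
        show "G u \<le> - (\<mu> * (a - u))" if "a \<le> u" "u < a" for u
          using inc[of u a] that 1 True by linarith
      qed (use 1 True in auto)
    next
      case 2
      show thesis
      proof (rule that[of b])
        show "\<mu> * (u - b) \<le> G u" if "b < u" "u \<le> b" for u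
          using inc[of b u] that 2 True by linarith
        show "G u \<le> - (\<mu> * (b - u))" if "a \<le> u" "u < b" for u
          using inc[of u b] that 2 True by linarith
      qed (use 2 True in auto)
    next
      case 3
      obtain z where z: "a \<le> z" "z \<le> b" "G z = 0" using IVT'[OF 3 True cG] by blast
      show thesis
      proof (rule that[of z])
        show "\<mu> * (u - z) \<le> G u" if "z < u" "u \<le> b" for u
          using inc[of z u] that z by linarith
        show "G u \<le> - (\<mu> * (z - u))" if "a \<le> u" "u < z" for u
          using inc[of u z] that z by linarith
      qed (use z in auto)
    qed
  qed
  \<comment> \<open>Clipped to the interval: where the window reaches an end, the flank there
    shrinks to a point.\<close>
  define p where "p = max a (z - \<delta>)"
  define q where "q = min b (z + \<delta>)"
  have pq: "a \<le> p" "p \<le> z" "z \<le> q" "q \<le> b" "q - p \<le> 2 * \<delta>"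
    using z \<delta> by (auto simp: p_def q_def)
  have int: "e integrable_on {u..v}" if "a \<le> u" "v \<le> b" for u v
    by (rule integrable_continuous_interval[OF continuous_on_subset[OF e(1)]]) (use that in auto)
  have "norm (integral {a..p} e) \<le> B"
  proof (cases "p = a")
    case False
    then have p: "p = z - \<delta>" using pq by (auto simp: p_def max_def split: if_splits)
    show ?thesis
    proof (rule neg)
      fix u assume u: "u \<in> {a..p}"
      have "G u \<le> - (\<mu> * (z - u))" using u p \<delta> by (intro zn) auto
      moreover have "\<mu> * \<delta> \<le> \<mu> * (z - u)" using u p mu by (intro mult_left_mono) auto
      ultimately show "G u \<le> - (\<mu> * \<delta>)" by simp
    qed (use pq z in auto)
  qed (use B in auto)
  moreover have "norm (integral {q..b} e) \<le> B"
  proof (cases "q = b")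
    case False
    then have q: "q = z + \<delta>" using pq by (auto simp: q_def min_def split: if_splits)
    show ?thesis
    proof (rule pos)
      fix u assume u: "u \<in> {q..b}"
      have "\<mu> * \<delta> \<le> \<mu> * (u - z)" using u q mu by (intro mult_left_mono) auto
      also have "\<dots> \<le> G u" using u q \<delta> by (intro zp) auto
      finally show "\<mu> * \<delta> \<le> G u" .
    qed (use pq z in auto)
  qed (use B in auto)
  moreover have "norm (integral {p..q} e) \<le> 1 * (q - p)"
    by (rule integral_bound) (use pq e in \<open>auto intro: continuous_on_subset\<close>)
  moreover have "integral {a..b} e = integral {a..p} e + integral {p..q} e + integral {q..b} e"
    using Henstock_Kurzweil_Integration.integral_combine[of a p q e]
      Henstock_Kurzweil_Integration.integral_combine[of a q b e] pq int by auto
  ultimately show ?thesis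
    using norm_triangle_ineq[of "integral {a..p} e + integral {p..q} e" "integral {q..b} e"]
      norm_triangle_ineq[of "integral {a..p} e" "integral {p..q} e"] pq by simp
next
  case False
  then show ?thesis using \<delta> B by simp
qed

text \<open>Uniformity in phase, interval and \<mu> is put into a predicate, so that one constant
  can be chosen for each order. The derivatives come as a sequence, which the induction on k can
  hand on as it is.\<close>

definition vdC_const :: "nat \<Rightarrow> real \<Rightarrow> bool" where
  "vdC_const k C \<longleftrightarrow> 0 \<le> C \<and> (\<forall>(F :: nat \<Rightarrow> real \<Rightarrow> real) a b \<mu> c. norm (c::complex) = 1 \<longrightarrow> Re c = 0 \<longrightarrow> 0 < \<mu> \<longrightarrow>
    (\<forall>j<k. \<forall>u\<in>{a..b}. (F j has_real_derivative F (Suc j) u) (at u within {a..b})) \<longrightarrow>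
    (\<forall>u\<in>{a..b}. \<mu> \<le> F k u) \<longrightarrow>
    norm (integral {a..b} (\<lambda>u. exp (F 0 u *\<^sub>R c))) \<le> C * \<mu> powr (- 1 / real k))"

text \<open>\<delta> balances the window against the flanks: it is chosen so that the bound of the
  preceding order at level \<open>\<mu> * \<delta>\<close> equals a multiple of \<delta>. The
  induction starts at order 2, where the positive second derivative supplies the sign condition of
  the first-order estimate.\<close>

lemma van_der_Corput:
  assumes "2 \<le> k"
  shows "\<exists>C. vdC_const k C"
  unfolding vdC_const_def
  using assms
proof (induction k rule: nat_induct_at_least)
  case base
  show ?case
  proof (intro exI[of _ 8] conjI allI impI)
    fix F :: "nat \<Rightarrow> real \<Rightarrow> real" and a b \<mu> :: real and c :: complex
    assume c: "norm c = 1" "Re c = 0" and mu: "0 < \<mu>"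
      and d: "\<forall>j<2. \<forall>u\<in>{a..b}. (F j has_real_derivative F (Suc j) u) (at u within {a..b})"
      and low: "\<forall>u\<in>{a..b}. \<mu> \<le> F 2 u"
    define \<delta> where "\<delta> = \<mu> powr (- 1 / 2)"
    have \<delta>: "0 < \<delta>" using mu by (simp add: \<delta>_def)
    have "\<mu> * \<delta> * \<delta> = \<mu> powr (1 + (-1/2) + (-1/2))"
      unfolding \<delta>_def powr_add using mu by simp
    then have md: "1 / (\<mu> * \<delta>) = \<delta>" using mu \<delta> by (simp add: field_simps)
    have d0: "(F 0 has_real_derivative F 1 u) (at u within S)" and d1: "(F 1 has_real_derivative F 2 u) (at u within S)"
      if "u \<in> {a..b}" "S \<subseteq> {a..b}" for u S
      using d[rule_format, of 0 u] d[rule_format, of 1 u] that DERIV_subset by (auto simp: numeral_2_eq_2)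
    have cF: "continuous_on {a..b} (F 0)"
      using d0 by (meson DERIV_continuous continuous_on_eq_continuous_within order_refl)
    have "norm (integral {a..b} (\<lambda>u. exp (F 0 u *\<^sub>R c))) \<le> 2 * \<delta> + 2 * (3 / (\<mu> * \<delta>))"
    proof (rule van_der_Corput_split[where G = "F 1" and G' = "F 2"])
      fix a' b' assume s: "{a'..b'} \<subseteq> {a..b}"
      have u: "u \<in> {a..b}" if "u \<in> {a'..b'}" for u using that s by blast
      show "norm (integral {a'..b'} (\<lambda>u. exp (F 0 u *\<^sub>R c))) \<le> 3 / (\<mu> * \<delta>)"
        if "\<And>u. u \<in> {a'..b'} \<Longrightarrow> \<mu> * \<delta> \<le> F 1 u"
      proof (rule van_der_Corput_first[where ?F1.0 = "F 1" and ?F2.0 = "F 2", OF c])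
        show "(\<forall>u\<in>{a'..b'}. 0 \<le> F 2 u) \<or> (\<forall>u\<in>{a'..b'}. F 2 u \<le> 0)"
          using low u mu by (metis less_eq_real_def order_trans)
      qed (use d0[OF u s] d1[OF u s] that mu \<delta> in auto)
      \<comment> \<open>Changing the sign of both the phase and \<open>c\<close> leaves the
        integrand as it is and makes the first derivative positive on this flank.\<close>
      have "norm (integral {a'..b'} (\<lambda>u. exp ((- F 0 u) *\<^sub>R (- c)))) \<le> 3 / (\<mu> * \<delta>)"
        if n: "\<And>u. u \<in> {a'..b'} \<Longrightarrow> F 1 u \<le> - (\<mu> * \<delta>)"
      proof (rule van_der_Corput_first[where ?F1.0 = "\<lambda>u. - F 1 u" and ?F2.0 = "\<lambda>u. - F 2 u"])
        show "(\<forall>u\<in>{a'..b'}. 0 \<le> - F 2 u) \<or> (\<forall>u\<in>{a'..b'}. - F 2 u \<le> 0)"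
          using low u mu by (metis less_eq_real_def neg_le_0_iff_le order_trans)
      next
        show "\<mu> * \<delta> \<le> - F 1 u" if "u \<in> {a'..b'}" for u using n[OF that] by simp
      qed (use c d0[OF u s] d1[OF u s] mu \<delta> in \<open>auto intro!: DERIV_minus\<close>)
      then show "norm (integral {a'..b'} (\<lambda>u. exp (F 0 u *\<^sub>R c))) \<le> 3 / (\<mu> * \<delta>)"
        if "\<And>u. u \<in> {a'..b'} \<Longrightarrow> F 1 u \<le> - (\<mu> * \<delta>)"
        using that by simp
    qed (use d1 mu low \<delta> c in \<open>auto intro!: continuous_intros cF\<close>)
    \<comment> \<open>8 = 2 + 2 * 3: the window and two flanks.\<close>
    also have "\<dots> = 8 * \<mu> powr (- 1 / real 2)" using md by (simp add: \<delta>_def)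
    finally show "norm (integral {a..b} (\<lambda>u. exp (F 0 u *\<^sub>R c))) \<le> 8 * \<mu> powr (- 1 / real 2)" .
  qed simp
next
  case (Suc k)
  obtain C where C: "C \<ge> 0" and IH: "\<And>(F :: nat \<Rightarrow> real \<Rightarrow> real) a b \<mu> c. norm (c::complex) = 1 \<Longrightarrow> Re c = 0 \<Longrightarrow> 0 < \<mu> \<Longrightarrow>
    (\<forall>j<k. \<forall>u\<in>{a..b}. (F j has_real_derivative F (Suc j) u) (at u within {a..b})) \<Longrightarrow>
    (\<forall>u\<in>{a..b}. \<mu> \<le> F k u) \<Longrightarrow>
    norm (integral {a..b} (\<lambda>u. exp (F 0 u *\<^sub>R c))) \<le> C * \<mu> powr (- 1 / real k)"
    using Suc.IH by blast
  show ?case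
  proof (intro exI[of _ "2 + 2 * C"] conjI allI impI)
    fix F :: "nat \<Rightarrow> real \<Rightarrow> real" and a b \<mu> :: real and c :: complex
    assume c: "norm c = 1" "Re c = 0" and mu: "0 < \<mu>"
      and d: "\<forall>j<Suc k. \<forall>u\<in>{a..b}. (F j has_real_derivative F (Suc j) u) (at u within {a..b})"
      and low: "\<forall>u\<in>{a..b}. \<mu> \<le> F (Suc k) u"
    define \<delta> where "\<delta> = \<mu> powr (- 1 / real (Suc k))"
    have \<delta>: "0 < \<delta>" using mu by (simp add: \<delta>_def)
    have k: "real k \<ge> 2" using Suc.hyps by simp
    have "\<mu> * \<delta> = \<mu> powr (real k / real (Suc k))"
    proof -
      have "\<mu> * \<delta> = \<mu> powr (1 + (- 1 / real (Suc k)))"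
        unfolding \<delta>_def powr_add using mu by simp
      also have "1 + (- 1 / real (Suc k)) = real k / real (Suc k)" by (simp add: field_simps)
      finally show ?thesis .
    qed
    then have md: "(\<mu> * \<delta>) powr (- 1 / real k) = \<delta>"
      using k by (simp add: powr_powr \<delta>_def)
    have ds: "(F j has_real_derivative F (Suc j) u) (at u within S)"
      if "u \<in> {a..b}" "S \<subseteq> {a..b}" "j \<le> k" for u S j
      using d[rule_format, of j u] that DERIV_subset by auto
    have cF: "continuous_on {a..b} (F 0)"
      using ds[of _ "{a..b}" 0] by (meson DERIV_continuous continuous_on_eq_continuous_within order_refl le0)
    have "norm (integral {a..b} (\<lambda>u. exp (F 0 u *\<^sub>R c))) \<le> 2 * \<delta> + 2 * (C * (\<mu> * \<delta>) powr (- 1 / real k))"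
    proof (rule van_der_Corput_split[where G = "F k" and G' = "F (Suc k)"])
      fix a' b' assume s: "{a'..b'} \<subseteq> {a..b}"
      have u: "u \<in> {a..b}" if "u \<in> {a'..b'}" for u using that s by blast
      show "norm (integral {a'..b'} (\<lambda>u. exp (F 0 u *\<^sub>R c))) \<le> C * (\<mu> * \<delta>) powr (- 1 / real k)"
        if "\<And>u. u \<in> {a'..b'} \<Longrightarrow> \<mu> * \<delta> \<le> F k u"
        using ds[OF u s] that mu \<delta> by (intro IH[OF c]) auto
      show "norm (integral {a'..b'} (\<lambda>u. exp (F 0 u *\<^sub>R c))) \<le> C * (\<mu> * \<delta>) powr (- 1 / real k)"
        if n: "\<And>u. u \<in> {a'..b'} \<Longrightarrow> F k u \<le> - (\<mu> * \<delta>)"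
      proof -
        have "norm (integral {a'..b'} (\<lambda>u. exp ((- F 0 u) *\<^sub>R (- c)))) \<le> C * (\<mu> * \<delta>) powr (- 1 / real k)"
        proof (rule IH[where F = "\<lambda>j u. - F j u"])
          show "\<forall>j<k. \<forall>u\<in>{a'..b'}. ((\<lambda>u. - F j u) has_real_derivative - F (Suc j) u) (at u within {a'..b'})"
            using ds[OF u s] by (auto intro!: DERIV_minus)
          show "\<forall>u\<in>{a'..b'}. \<mu> * \<delta> \<le> - F k u" using n by force
        qed (use c mu \<delta> in auto)
        then show ?thesis by simp
      qed
    qed (use ds[of _ "{a..b}" k] mu low \<delta> c C in \<open>auto intro!: continuous_intros cF\<close>)
    also have "\<dots> = (2 + 2 * C) * \<mu> powr (- 1 / real (Suc k))" unfolding md by (simp add: \<delta>_def algebra_simps)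
    finally show "norm (integral {a..b} (\<lambda>u. exp (F 0 u *\<^sub>R c))) \<le> (2 + 2 * C) * \<mu> powr (- 1 / real (Suc k))" .
  qed (use C in simp)
qed

section \<open>Uniform decay of oscillatory integrals in the plane\<close>

definition osc :: "(real \<times> real \<Rightarrow> real \<times> real) \<Rightarrow> real \<times> real \<Rightarrow> real \<times> real \<Rightarrow> real \<times> real \<Rightarrow> complex" where
  "osc \<phi> \<xi>1 \<xi>2 x = exp (- \<i> * complex_of_real (inner x \<xi>1 + inner (\<phi> x) \<xi>2))"

lemma norm_osc [simp]: "norm (osc \<phi> \<xi>1 \<xi>2 x) = 1"
  unfolding osc_def by (simp only: norm_exp_eq_Re) simp

lemma continuous_on_osc:
  "continuous_on S \<phi> \<Longrightarrow> continuous_on S (osc \<phi> \<xi>1 \<xi>2)"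
  unfolding osc_def[abs_def] by (intro continuous_intros)

text \<open>The part of the phase that contains \<xi>1 is affine along the segment, so
  \<open>L\<close> disappears from all derivatives of order two and more; this makes the bound
  independent of \<xi>1.\<close>

lemma osc_slice_bound:
  fixes \<phi> :: "real \<times> real \<Rightarrow> real \<times> real"
  assumes an: "real_analytic2_on (\<lambda>x. fst (\<phi> x)) U" "real_analytic2_on (\<lambda>x. snd (\<phi> x)) U"
    and sub: "\<And>u. u \<in> {a..b} \<Longrightarrow> (y + \<epsilon> * u, u) \<in> U"
    and k: "2 \<le> k" and C: "vdC_const k C" and \<tau>: "\<bar>\<tau>\<bar> = 1" and \<mu>: "0 < \<mu>"
    and low: "\<And>u. u \<in> {a..b} \<Longrightarrow> \<mu> \<le> \<tau> * (fst \<xi>2 * (Dd \<epsilon> ^^ k) (\<lambda>x. fst (\<phi> x)) (y + \<epsilon> * u, u)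
        + snd \<xi>2 * (Dd \<epsilon> ^^ k) (\<lambda>x. snd (\<phi> x)) (y + \<epsilon> * u, u))"
  shows "norm (integral {a..b} (\<lambda>u. osc \<phi> \<xi>1 \<xi>2 (y + \<epsilon> * u, u))) \<le> C * \<mu> powr (- 1 / real k)"
proof -
  define L :: "nat \<Rightarrow> real \<Rightarrow> real" where "L = (\<lambda>j u. if j = 0 then (y + \<epsilon> * u) * fst \<xi>1 + u * snd \<xi>1
      else if j = 1 then \<epsilon> * fst \<xi>1 + snd \<xi>1 else (0::real))"
  define F where "F = (\<lambda>j u. \<tau> * (L j u + (fst \<xi>2 * (Dd \<epsilon> ^^ j) (\<lambda>x. fst (\<phi> x)) (y + \<epsilon> * u, u)
        + snd \<xi>2 * (Dd \<epsilon> ^^ j) (\<lambda>x. snd (\<phi> x)) (y + \<epsilon> * u, u))))"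
  \<comment> \<open>The sign \<tau> enters twice, in \<open>F\<close> and in \<open>c\<close>, and
    cancels: the integrand is unchanged while the k-th derivative becomes positive.\<close>
  define c where "c = - \<i> * complex_of_real \<tau>"
  have "\<tau> * \<tau> = 1" using \<tau> by (metis abs_mult_self_eq mult_1)
  then have tt: "complex_of_real \<tau> * complex_of_real \<tau> = 1"
    by (metis of_real_1 of_real_mult)
  have e: "exp (F 0 u *\<^sub>R c) = osc \<phi> \<xi>1 \<xi>2 (y + \<epsilon> * u, u)" for u
  proof -
    have "F 0 u *\<^sub>R c = (complex_of_real \<tau> * complex_of_real \<tau>) * (- \<i> * complex_of_real (L 0 u + (fst \<xi>2 * fst (\<phi> (y + \<epsilon> * u, u))
        + snd \<xi>2 * snd (\<phi> (y + \<epsilon> * u, u)))))"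
      by (simp add: F_def c_def scaleR_conv_of_real)
    then show ?thesis unfolding osc_def tt by (simp add: L_def inner_prod_def mult_ac)
  qed
  have "norm (integral {a..b} (\<lambda>u. exp (F 0 u *\<^sub>R c))) \<le> C * \<mu> powr (- 1 / real k)"
  proof (rule C[unfolded vdC_const_def, THEN conjunct2, rule_format])
    show "norm c = 1" "Re c = 0" using \<tau> by (auto simp: c_def norm_mult)
    show "\<mu> \<le> F k u" if "u \<in> {a..b}" for u
      using low[OF that] k by (simp add: F_def L_def)
    fix j u assume u: "u \<in> {a..b}"
    have "(L j has_real_derivative L (Suc j) u) (at u)"
      unfolding L_def by (cases "j = 0"; cases "j = 1") (auto intro!: derivative_eq_intros)
    moreover have "((\<lambda>u. (Dd \<epsilon> ^^ j) g (y + \<epsilon> * u, u)) has_real_derivative (Dd \<epsilon> ^^ Suc j) g (y + \<epsilon> * u, u)) (at u)"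
      if "real_analytic2_on g U" for g
      using real_analytic2_DERIV_Dd[OF real_analytic2_on_Dd_pow[OF that] sub[OF u]] by simp
    ultimately have "(F j has_real_derivative F (Suc j) u) (at u)"
      unfolding F_def using an by (intro DERIV_cmult DERIV_add)
    then show "(F j has_real_derivative F (Suc j) u) (at u within {a..b})"
      by (rule has_field_derivative_at_within)
  qed (rule \<mu>)
  then show ?thesis by (simp add: e)
qed

text \<open>Fubini along (\<epsilon>, 1): the shear (y, u) -> (y + \<epsilon> u, u) preserves area,
  and van der Corput applies on each segment. The lower bound is asked on the closure because the
  one-dimensional estimate is for closed intervals. The factor 4R is the length of the range of y,
  as |y| \<le> |y + \<epsilon> u| + |u| \<le> 2R.\<close>

lemma osc_piece_bound:
  fixes \<phi> :: "real \<times> real \<Rightarrow> real \<times> real"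
  assumes an: "real_analytic2_on (\<lambda>x. fst (\<phi> x)) U" "real_analytic2_on (\<lambda>x. snd (\<phi> x)) U"
    and B: "B \<in> sets borel" "closure B \<subseteq> U" "B \<subseteq> {-R..R} \<times> {-R..R}"
    and \<epsilon>: "0 \<le> \<epsilon>" "\<epsilon> \<le> 1" and R: "0 \<le> R"
    and sect: "\<And>y. is_interval {u. (y + \<epsilon> * u, u) \<in> B}"
    and k: "2 \<le> k" and C: "vdC_const k C" and \<tau>: "\<bar>\<tau>\<bar> = 1" and \<mu>: "0 < \<mu>"
    and low: "\<And>x. x \<in> closure B \<Longrightarrow> \<mu> \<le> \<tau> * (fst \<xi>2 * (Dd \<epsilon> ^^ k) (\<lambda>x. fst (\<phi> x)) x
        + snd \<xi>2 * (Dd \<epsilon> ^^ k) (\<lambda>x. snd (\<phi> x)) x)"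
  shows "norm (LINT x:B|lborel. osc \<phi> \<xi>1 \<xi>2 x) \<le> 4 * R * (C * \<mu> powr (- 1 / real k))"
proof -
  define W where "W = C * \<mu> powr (- 1 / real k)"
  have W: "W \<ge> 0" using C by (simp add: W_def vdC_const_def)
  have c\<phi>: "continuous_on U \<phi>"
    using continuous_on_Pair[OF an[THEN real_analytic2_imp_continuous_on]] by simp
  have Bbox: "\<bar>p\<bar> \<le> R \<and> \<bar>q\<bar> \<le> R" if "(p, q) \<in> B" for p q
    using subsetD[OF B(3) that] by auto
  have BU: "B \<subseteq> U" using B closure_subset by blast
  define g where "g = (\<lambda>x. indicator B x *\<^sub>R osc \<phi> \<xi>1 \<xi>2 x)"
  have gm [measurable]: "g \<in> borel_measurable borel"
    unfolding g_def by (intro borel_measurable_continuous_on_indicator B continuous_on_osc continuous_on_subset[OF c\<phi> BU])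
  have shm: "(\<lambda>(y, u). g (y + \<epsilon> * u, u)) \<in> borel_measurable borel"
    unfolding case_prod_unfold by (rule measurable_compose[OF _ gm], rule borel_measurable_continuous_onI) (intro continuous_intros)
  have gb: "norm (g x) \<le> indicator ({-R..R} \<times> {-R..R}) x" for x
    using B(3) by (auto simp: g_def split: split_indicator)
  have bi: "integrable lborel (indicator ({-q..q} \<times> {-R..R}) :: real \<times> real \<Rightarrow> real)" for q
  proof -
    have "{-q..q} \<times> {-R..R} = cbox (-q,-R) (q,R)" by (auto simp: cbox_Pair_eq)
    then show ?thesis using emeasure_lborel_cbox_finite by (auto intro!: integrable_real_indicator)
  qed
  have gi: "integrable (lborel \<Otimes>\<^sub>M lborel) (case_prod (\<lambda>x1 x2. g (x1, x2)))"
    unfolding lborel_prod using gb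
    by (intro Bochner_Integration.integrable_bound[OF bi[of R]]) (auto simp: gm)
  have shi: "integrable (lborel \<Otimes>\<^sub>M lborel) (\<lambda>(y, u). g (y + \<epsilon> * u, u))"
    unfolding lborel_prod
  proof (rule Bochner_Integration.integrable_bound[OF bi[of "2 * R"]])
    show "(\<lambda>(y, u). g (y + \<epsilon> * u, u)) \<in> borel_measurable lborel" using shm by simp
    have "norm (g (y + \<epsilon> * u, u)) \<le> indicator ({- (2 * R)..2 * R} \<times> {- R..R}) (y, u)" for y u
    proof (cases "(y + \<epsilon> * u, u) \<in> B")
      case True
      then have 1: "\<bar>y + \<epsilon> * u\<bar> \<le> R" "\<bar>u\<bar> \<le> R" using Bbox by blast+
      have "\<bar>\<epsilon> * u\<bar> \<le> 1 * R" unfolding abs_mult using 1 \<epsilon> by (intro mult_mono) auto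
      then have "\<bar>y\<bar> \<le> 2 * R" using 1 by linarith
      then show ?thesis using 1 by (auto simp: g_def indicator_def)
    qed (simp add: g_def)
    then show "AE x in lborel. norm (case x of (y, u) \<Rightarrow> g (y + \<epsilon> * u, u)) \<le> norm (indicator ({- (2 * R)..2 * R} \<times> {- R..R}) x :: real)"
      by (intro AE_I2) (auto simp: case_prod_unfold)
  qed
  have "(LINT x:B|lborel. osc \<phi> \<xi>1 \<xi>2 x) = integral\<^sup>L (lborel \<Otimes>\<^sub>M lborel) (case_prod (\<lambda>x1 x2. g (x1, x2)))"
    by (simp add: set_lebesgue_integral_def g_def lborel_prod case_prod_unfold)
  also have "\<dots> = (\<integral>u. (\<integral>x1. g (x1, u) \<partial>lborel) \<partial>lborel)"
    using lborel_pair.integral_snd[OF gi] by simp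
  \<comment> \<open>For fixed u the shear is a translation in y, under which the inner integral is
    invariant.\<close>
  also have "\<dots> = (\<integral>u. (\<integral>y. g (y + \<epsilon> * u, u) \<partial>lborel) \<partial>lborel)"
  proof (rule Bochner_Integration.integral_cong[OF refl])
    show "(\<integral>x1. g (x1, u) \<partial>lborel) = (\<integral>y. g (y + \<epsilon> * u, u) \<partial>lborel)" for u
      using lborel_integral_real_affine[of 1 "\<lambda>x1. g (x1, u)" "\<epsilon> * u"] by (simp add: add.commute)
  qed
  also have "\<dots> = (\<integral>y. (\<integral>u. g (y + \<epsilon> * u, u) \<partial>lborel) \<partial>lborel)"
    using lborel_pair.Fubini_integral[OF shi] by simp
  finally have eq: "(LINT x:B|lborel. osc \<phi> \<xi>1 \<xi>2 x) = (\<integral>y. (\<integral>u. g (y + \<epsilon> * u, u) \<partial>lborel) \<partial>lborel)" .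
  have inner: "norm (\<integral>u. g (y + \<epsilon> * u, u) \<partial>lborel) \<le> W * indicator {- (2 * R)..2 * R} y" for y
  proof (cases "{u. (y + \<epsilon> * u, u) \<in> B} = {}")
    case True
    then have "g (y + \<epsilon> * u, u) = 0" for u by (auto simp: g_def)
    then show ?thesis using W by simp
  next
    case False
    define J where "J = {u. (y + \<epsilon> * u, u) \<in> B}"
    have J: "J \<noteq> {}" "J \<subseteq> {-R..R}" using False B(3) by (auto simp: J_def)
    then have bdd: "bdd_below J" "bdd_above J" by (meson bdd_below_Icc bdd_below_mono bdd_above_Icc bdd_above_mono)+
    define a where "a = Inf J"
    define b where "b = Sup J"
    have Jab: "J \<subseteq> {a..b}" using bdd by (auto simp: a_def b_def cInf_lower cSup_upper)
    have abJ: "u \<in> J" if au: "a < u" and ub: "u < b" for u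
    proof -
      obtain p where "p \<in> J" "p < u" using au[unfolded a_def cInf_less_iff[OF J(1) bdd(1)]] by blast
      moreover obtain q where "q \<in> J" "u < q" using ub[unfolded b_def less_cSup_iff[OF J(1) bdd(2)]] by blast
      ultimately show ?thesis using sect[of y] unfolding J_def[symmetric] is_interval_1 by (meson less_imp_le)
    qed
    have cl: "(y + \<epsilon> * u, u) \<in> closure B" if "u \<in> {a..b}" for u
    proof -
      have "u \<in> closure J"
      proof (cases "a < u \<and> u < b")
        case True then show ?thesis using abJ closure_subset by blast
      next
        case False
        then have "u = a \<or> u = b" using that by auto
        then show ?thesis using closure_contains_Inf[OF J(1) bdd(1)] closure_contains_Sup[OF J(1) bdd(2)]
          by (auto simp: a_def b_def)
      qed
      moreover have "(\<lambda>u. (y + \<epsilon> * u, u)) ` closure J \<subseteq> closure B"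
      proof (rule image_closure_subset)
        show "continuous_on (closure J) (\<lambda>u. (y + \<epsilon> * u, u))" by (intro continuous_intros)
        show "(\<lambda>u. (y + \<epsilon> * u, u)) ` J \<subseteq> closure B" using closure_subset by (auto simp: J_def)
      qed simp
      ultimately show ?thesis by blast
    qed
    \<comment> \<open>The section \<open>J\<close> may lack one or both endpoints of [a, b]; two
      points are a null set.\<close>
    have "(\<integral>u. g (y + \<epsilon> * u, u) \<partial>lborel) = (\<integral>u. indicator {a..b} u *\<^sub>R osc \<phi> \<xi>1 \<xi>2 (y + \<epsilon> * u, u) \<partial>lborel)"
    proof (rule integral_discrete_difference[of "{a, b}"])
      fix u assume "u \<notin> {a, b}"
      then have "u \<in> J \<longleftrightarrow> u \<in> {a..b}" using abJ Jab by fastforce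
      then show "g (y + \<epsilon> * u, u) = indicator {a..b} u *\<^sub>R osc \<phi> \<xi>1 \<xi>2 (y + \<epsilon> * u, u)"
        by (simp add: g_def J_def indicator_def)
    qed auto
    also have "\<dots> = integral {a..b} (\<lambda>u. osc \<phi> \<xi>1 \<xi>2 (y + \<epsilon> * u, u))"
    proof -
      have "continuous_on {a..b} (\<lambda>u. \<phi> (y + \<epsilon> * u, u))"
        by (rule continuous_on_compose2[OF c\<phi>]) (use cl B in \<open>auto intro!: continuous_intros\<close>)
      then have "continuous_on {a..b} (\<lambda>u. osc \<phi> \<xi>1 \<xi>2 (y + \<epsilon> * u, u))"
        unfolding osc_def by (intro continuous_intros)
      then have "set_integrable lborel {a..b} (\<lambda>u. osc \<phi> \<xi>1 \<xi>2 (y + \<epsilon> * u, u))"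
        unfolding set_integrable_def by (intro borel_integrable_compact) auto
      from set_borel_integral_eq_integral(2)[OF this] show ?thesis
        by (simp add: set_lebesgue_integral_def)
    qed
    also have "norm \<dots> \<le> W" unfolding W_def
      by (rule osc_slice_bound[OF an _ k C \<tau> \<mu>]) (use cl B low in blast)+
    finally have le: "norm (\<integral>u. g (y + \<epsilon> * u, u) \<partial>lborel) \<le> W" .
    obtain u where "u \<in> J" using J by blast
    then have 1: "\<bar>y + \<epsilon> * u\<bar> \<le> R" "\<bar>u\<bar> \<le> R" using Bbox by (auto simp: J_def)
    have "\<bar>\<epsilon> * u\<bar> \<le> 1 * R" unfolding abs_mult using 1 \<epsilon> by (intro mult_mono) auto
    then have "\<bar>y\<bar> \<le> 2 * R" using 1 by linarith
    then show ?thesis using le by (auto simp: indicator_def)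
  qed
  have "norm (LINT x:B|lborel. osc \<phi> \<xi>1 \<xi>2 x) \<le> (\<integral>y. norm (\<integral>u. g (y + \<epsilon> * u, u) \<partial>lborel) \<partial>lborel)"
    unfolding eq by (rule integral_norm_bound)
  also have "\<dots> \<le> (\<integral>y. W * indicator {- (2 * R)..2 * R} y \<partial>lborel)"
    by (rule integral_mono') (use inner W R in \<open>auto simp: emeasure_lborel_Icc_eq intro!: integrable_real_indicator integrable_mult_right\<close>)
  also have "\<dots> = W * (4 * R)" using R by simp
  finally show ?thesis by (simp add: W_def mult_ac)
qed

section \<open>Integrability and the trivial bound\<close>

lemma set_integrable_osc:
  fixes \<phi> :: "real \<times> real \<Rightarrow> real \<times> real"
  assumes "continuous_on B \<phi>" "B \<in> sets borel" "B \<subseteq> {-R..R} \<times> {-R..R}"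
  shows "set_integrable lborel B (osc \<phi> \<xi>1 \<xi>2)"
  unfolding set_integrable_def
proof (rule Bochner_Integration.integrable_bound)
  have "{-R..R} \<times> {-R..R} = cbox (-R,-R) (R,R)" by (auto simp: cbox_Pair_eq)
  then show "integrable lborel (indicator ({-R..R} \<times> {-R..R}) :: real \<times> real \<Rightarrow> real)"
    using emeasure_lborel_cbox_finite by (auto intro!: integrable_real_indicator)
  have "(\<lambda>x. indicator B x *\<^sub>R osc \<phi> \<xi>1 \<xi>2 x) \<in> borel_measurable borel"
    by (intro borel_measurable_continuous_on_indicator assms continuous_on_osc)
  then show "(\<lambda>x. indicator B x *\<^sub>R osc \<phi> \<xi>1 \<xi>2 x) \<in> borel_measurable lborel" by simp
qed (use assms(3) in \<open>auto split: split_indicator\<close>)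

lemma norm_set_integral_osc_le:
  fixes \<phi> :: "real \<times> real \<Rightarrow> real \<times> real"
  assumes "continuous_on B \<phi>" "B \<in> sets borel" "B \<subseteq> {-R..R} \<times> {-R..R}"
  shows "norm (LINT x:B|lborel. osc \<phi> \<xi>1 \<xi>2 x) \<le> measure lborel B"
proof -
  have "norm (LINT x:B|lborel. osc \<phi> \<xi>1 \<xi>2 x) \<le> (LINT x:B|lborel. norm (osc \<phi> \<xi>1 \<xi>2 x))"
    by (rule set_integral_norm_bound[OF set_integrable_osc[OF assms]])
  then show ?thesis by (simp add: set_lebesgue_integral_def)
qed

section \<open>Uniform nondegeneracy by compactness\<close>

lemma sign_stable:
  fixes \<tau> X Y \<eta> :: real
  assumes "\<bar>\<tau>\<bar> = 1" "\<bar>X - Y\<bar> \<le> \<eta>" "\<tau> * X = \<bar>X\<bar>" "2 * \<eta> \<le> \<bar>X\<bar>"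
  shows "\<eta> \<le> \<tau> * Y"
proof -
  have "\<tau> * (X - Y) \<le> \<bar>\<tau> * (X - Y)\<bar>" by (rule abs_ge_self)
  also have "\<dots> = \<bar>X - Y\<bar>" using assms(1) by (simp only: abs_mult mult_1)
  finally show ?thesis using assms(2-4) by (simp only: right_diff_distrib)
qed

text \<open>One index and one sign must serve a whole ball around x, because on each piece van der
  Corput is applied with a single order and direction. The sum of the moduli is continuous and
  positive on the compact set \<open>K \<times> sphere 0 1\<close>, which bounds its largest term
  from below; uniform continuity of the coefficients carries this to nearby points, with a radius
  independent of \<zeta>.\<close>

lemma uniform_nondegeneracy:
  fixes D :: "'i \<Rightarrow> 'a::metric_space \<Rightarrow> real" and D' :: "'i \<Rightarrow> 'a \<Rightarrow> real"
  assumes K: "compact K" and I: "finite I"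
    and cont: "\<And>i. i \<in> I \<Longrightarrow> continuous_on K (D i)" "\<And>i. i \<in> I \<Longrightarrow> continuous_on K (D' i)"
    and nz: "\<And>x \<zeta>. x \<in> K \<Longrightarrow> \<zeta> \<in> sphere (0 :: real \<times> real) 1 \<Longrightarrow>
      \<exists>i\<in>I. fst \<zeta> * D i x + snd \<zeta> * D' i x \<noteq> 0"
  obtains r \<eta> where "0 < r" "0 < \<eta>" "\<And>x \<zeta>. x \<in> K \<Longrightarrow> \<zeta> \<in> sphere 0 1 \<Longrightarrow>
      \<exists>i\<in>I. \<exists>\<tau>. \<bar>\<tau>\<bar> = 1 \<and> (\<forall>y\<in>K. dist x y < r \<longrightarrow> \<eta> \<le> \<tau> * (fst \<zeta> * D i y + snd \<zeta> * D' i y))"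
proof (cases "K = {}")
  case True
  then show thesis using that[of 1 1] by simp
next
  case False
  define S where "S = K \<times> sphere (0 :: real \<times> real) 1"
  define N where "N = (\<lambda>z. \<Sum>i\<in>I. \<bar>fst (snd z) * D i (fst z) + snd (snd z) * D' i (fst z)\<bar>)"
  have S: "compact S" unfolding S_def by (intro compact_Times K compact_sphere)
  have "(1, 0) \<in> sphere (0 :: real \<times> real) 1" by (simp add: norm_Pair)
  then have S0: "S \<noteq> {}" using False by (auto simp: S_def)
  have cS: "continuous_on S (\<lambda>z. f (fst z))" if "continuous_on K f" for f :: "'a \<Rightarrow> real"
    by (rule continuous_on_compose2[OF that]) (auto simp: S_def intro!: continuous_intros)
  have cN: "continuous_on S N"
    unfolding N_def by (intro continuous_intros cS cont)
  obtain z0 where z0: "z0 \<in> S" "\<And>z. z \<in> S \<Longrightarrow> N z0 \<le> N z"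
    using continuous_attains_inf[OF S S0 cN] by blast
  have nn: "0 \<le> N z" for z unfolding N_def by (intro sum_nonneg) simp
  have "N z0 \<noteq> 0"
  proof
    assume "N z0 = 0"
    then have "\<forall>i\<in>I. fst (snd z0) * D i (fst z0) + snd (snd z0) * D' i (fst z0) = 0"
      unfolding N_def using I by (subst (asm) sum_nonneg_eq_0_iff) auto
    then show False using nz[of "fst z0" "snd z0"] z0(1) by (auto simp: S_def)
  qed
  then have N0: "0 < N z0" using nn[of z0] by simp
  then have I0: "I \<noteq> {}" unfolding N_def by auto
  define n where "n = real (card I)"
  have n: "n > 0" using I I0 by (simp add: n_def card_gt_0_iff)
  \<comment> \<open>Some term is at least the mean \<open>N z0 / n\<close>, that is 2\<eta>. Half of
    this is given away to the variation over the ball, \<eta>/2 for each of the two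
    coefficients.\<close>
  define \<eta> where "\<eta> = N z0 / (2 * n)"
  have \<eta>: "0 < \<eta>" using N0 n by (simp add: \<eta>_def)
  have "\<exists>r>0. \<forall>x\<in>K. \<forall>y\<in>K. dist x y < r \<longrightarrow> \<bar>D i x - D i y\<bar> < \<eta>/2 \<and> \<bar>D' i x - D' i y\<bar> < \<eta>/2"
    if i: "i \<in> I" for i
  proof -
    have "uniformly_continuous_on K (D i)" "uniformly_continuous_on K (D' i)"
      using compact_uniformly_continuous K cont i by blast+
    note uc = this[unfolded uniformly_continuous_on_def, rule_format, OF half_gt_zero[OF \<eta>]]
    obtain r1 where r1: "r1 > 0" "\<And>x y. x \<in> K \<Longrightarrow> y \<in> K \<Longrightarrow> dist x y < r1 \<Longrightarrow> dist (D i x) (D i y) < \<eta>/2"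
      using uc(1) by blast
    obtain r2 where r2: "r2 > 0" "\<And>x y. x \<in> K \<Longrightarrow> y \<in> K \<Longrightarrow> dist x y < r2 \<Longrightarrow> dist (D' i x) (D' i y) < \<eta>/2"
      using uc(2) by blast
    show ?thesis
      using r1 r2 by (intro exI[of _ "min r1 r2"]) (simp add: dist_real_def)
  qed
  then have "\<forall>i\<in>I. \<exists>r>0. \<forall>x\<in>K. \<forall>y\<in>K. dist x y < r \<longrightarrow> \<bar>D i x - D i y\<bar> < \<eta>/2 \<and> \<bar>D' i x - D' i y\<bar> < \<eta>/2"
    by blast
  from bchoice[OF this] obtain \<rho> where \<rho>: "\<And>i. i \<in> I \<Longrightarrow> 0 < \<rho> i"
    "\<And>i x y. i \<in> I \<Longrightarrow> x \<in> K \<Longrightarrow> y \<in> K \<Longrightarrow> dist x y < \<rho> i \<Longrightarrow> \<bar>D i x - D i y\<bar> < \<eta>/2 \<and> \<bar>D' i x - D' i y\<bar> < \<eta>/2"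
    by blast
  define r where "r = Min (\<rho> ` I)"
  have r: "0 < r" "\<And>i. i \<in> I \<Longrightarrow> r \<le> \<rho> i" using I I0 \<rho>(1) by (auto simp: r_def)
  show thesis
  proof (rule that[OF r(1) \<eta>])
    fix x and \<zeta> :: "real \<times> real" assume x: "x \<in> K" and \<zeta>: "\<zeta> \<in> sphere 0 1"
    let ?T = "\<lambda>i y. fst \<zeta> * D i y + snd \<zeta> * D' i y"
    have "N z0 \<le> (\<Sum>i\<in>I. \<bar>?T i x\<bar>)"
      using z0(2)[of "(x, \<zeta>)"] x \<zeta> by (simp add: S_def N_def)
    moreover have "(\<Sum>i\<in>I. \<bar>?T i x\<bar>) < n * (2 * \<eta>)" if "\<forall>i\<in>I. \<bar>?T i x\<bar> < 2 * \<eta>"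
      unfolding n_def using sum_strict_mono[OF I I0, of "\<lambda>i. \<bar>?T i x\<bar>" "\<lambda>_. 2 * \<eta>"] that by simp
    moreover have "n * (2 * \<eta>) = N z0" using n by (simp add: \<eta>_def)
    ultimately obtain i where i: "i \<in> I" "2 * \<eta> \<le> \<bar>?T i x\<bar>" by (metis not_le)
    define \<tau> where "\<tau> = sgn (?T i x)"
    have \<tau>: "\<bar>\<tau>\<bar> = 1" "\<tau> * ?T i x = \<bar>?T i x\<bar>" using i \<eta> by (auto simp: \<tau>_def sgn_if)
    have "\<eta> \<le> \<tau> * ?T i y" if "y \<in> K" "dist x y < r" for y
    proof -
      have d: "\<bar>D i x - D i y\<bar> < \<eta>/2" "\<bar>D' i x - D' i y\<bar> < \<eta>/2"
        using \<rho>(2)[OF i(1) x that(1)] that(2) r(2)[OF i(1)] by auto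
      have \<zeta>1: "\<bar>fst \<zeta>\<bar> \<le> 1" "\<bar>snd \<zeta>\<bar> \<le> 1"
        using \<zeta> norm_fst_le[of "fst \<zeta>" "snd \<zeta>"] norm_snd_le[of "snd \<zeta>" "fst \<zeta>"] by auto
      have "\<bar>fst \<zeta> * (D i x - D i y)\<bar> \<le> 1 * (\<eta>/2)" "\<bar>snd \<zeta> * (D' i x - D' i y)\<bar> \<le> 1 * (\<eta>/2)"
        unfolding abs_mult by (rule mult_mono; use d \<zeta>1 in simp)+
      moreover have "?T i x - ?T i y = fst \<zeta> * (D i x - D i y) + snd \<zeta> * (D' i x - D' i y)"
        by (simp add: algebra_simps)
      ultimately have "\<bar>?T i x - ?T i y\<bar> \<le> \<eta>" by linarith
      from sign_stable[OF \<tau>(1) this \<tau>(2) i(2)] show ?thesis .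
    qed
    then show "\<exists>i\<in>I. \<exists>\<tau>. \<bar>\<tau>\<bar> = 1 \<and> (\<forall>y\<in>K. dist x y < r \<longrightarrow> \<eta> \<le> \<tau> * ?T i y)"
      using i \<tau> by blast
  qed
qed

text \<open>\<open>A\<close> is cut into squares on each of which direction, order and sign are
  fixed. The squares do not depend on the frequencies, although the choice made on each of them
  depends on the direction of \<xi>2. Among the admissible orders p - 1 gives the slowest decay and
  hence the exponent.\<close>

lemma osc_decay:
  fixes \<phi> :: "real \<times> real \<Rightarrow> real \<times> real" and E :: "real set"
  assumes an: "real_analytic2_on (\<lambda>x. fst (\<phi> x)) U" "real_analytic2_on (\<lambda>x. snd (\<phi> x)) U"
    and A: "A \<in> sets borel" "closure A \<subseteq> U" "A \<subseteq> {-R..R} \<times> {-R..R}"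
    and E: "finite E" "\<And>\<epsilon>. \<epsilon> \<in> E \<Longrightarrow> 0 \<le> \<epsilon> \<and> \<epsilon> \<le> 1" and R: "0 < R" and p: "3 \<le> p"
    and sect: "\<And>\<epsilon> y. \<epsilon> \<in> E \<Longrightarrow> is_interval {u. (y + \<epsilon> * u, u) \<in> A}"
    and nz: "\<And>x \<zeta>. x \<in> closure A \<Longrightarrow> \<zeta> \<in> sphere 0 1 \<Longrightarrow> \<exists>\<epsilon>\<in>E. \<exists>k\<in>{2..<p}.
        fst \<zeta> * (Dd \<epsilon> ^^ k) (\<lambda>x. fst (\<phi> x)) x + snd \<zeta> * (Dd \<epsilon> ^^ k) (\<lambda>x. snd (\<phi> x)) x \<noteq> 0"
  obtains C where "0 < C" "\<And>\<xi>1 \<xi>2. \<xi>2 \<noteq> 0 \<Longrightarrow>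
      norm (LINT x:A|lborel. osc \<phi> \<xi>1 \<xi>2 x) \<le> C * norm \<xi>2 powr (- 1 / real (p - 1))"
proof -
  define K where "K = closure A"
  have "bounded A" by (rule bounded_subset[OF _ A(3)]) (auto intro!: bounded_Times)
  then have K: "compact K" by (simp add: K_def)
  have AK: "A \<subseteq> K" by (simp add: K_def closure_subset)
  have cD: "continuous_on K ((Dd \<epsilon> ^^ k) g)" if "real_analytic2_on g U" for g \<epsilon> k
    using real_analytic2_imp_continuous_on[OF real_analytic2_on_Dd_pow[OF that]] A(2)
    by (auto simp: K_def intro: continuous_on_subset)
  have c\<phi>: "continuous_on U \<phi>"
    using continuous_on_Pair[OF an[THEN real_analytic2_imp_continuous_on]] by simp
  have c\<phi>A: "continuous_on A \<phi>" using c\<phi> AK A(2) by (auto simp: K_def intro: continuous_on_subset)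
  obtain r \<eta> where r: "0 < r" and \<eta>: "0 < \<eta>" and nd: "\<And>x \<zeta>. x \<in> K \<Longrightarrow> \<zeta> \<in> sphere 0 1 \<Longrightarrow>
      \<exists>i\<in>E \<times> {2..<p}. \<exists>\<tau>. \<bar>\<tau>\<bar> = 1 \<and> (\<forall>y\<in>K. dist x y < r \<longrightarrow>
        \<eta> \<le> \<tau> * (fst \<zeta> * (Dd (fst i) ^^ snd i) (\<lambda>x. fst (\<phi> x)) y + snd \<zeta> * (Dd (fst i) ^^ snd i) (\<lambda>x. snd (\<phi> x)) y))"
    by (rule uniform_nondegeneracy[OF K, of "E \<times> {2..<p}"
          "\<lambda>i. (Dd (fst i) ^^ snd i) (\<lambda>x. fst (\<phi> x))" "\<lambda>i. (Dd (fst i) ^^ snd i) (\<lambda>x. snd (\<phi> x))"])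
       (use E cD an nz in \<open>auto simp: K_def\<close>)
  \<comment> \<open>Two points of a square of side r/4 are at distance at most r/2, so even its
    closure stays inside the ball of radius r around any of its points. The squares are half-open,
    as level sets of floor functions, and hence disjoint.\<close>
  define h where "h = r / 4"
  have h: "h > 0" using r by (simp add: h_def)
  define N where "N = \<lceil>R / h\<rceil> + 1"
  define I where "I = {-N..N} \<times> {-N..N}"
  define cell where "cell = (\<lambda>z. {real_of_int (fst z) * h..<(real_of_int (fst z) + 1) * h}
      \<times> {real_of_int (snd z) * h..<(real_of_int (snd z) + 1) * h})"
  have fin: "finite I" by (simp add: I_def)
  have floor_cell: "t \<in> {real_of_int i * h..<(real_of_int i + 1) * h} \<longleftrightarrow> \<lfloor>t / h\<rfloor> = i" for t i
    using h by (auto simp: floor_eq_iff field_simps)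
  have AU: "A = (\<Union>z\<in>I. A \<inter> cell z)"
  proof
    show "A \<subseteq> (\<Union>z\<in>I. A \<inter> cell z)"
    proof
      fix x assume x: "x \<in> A"
      have "\<lfloor>t / h\<rfloor> \<in> {-N..N}" if "\<bar>t\<bar> \<le> R" for t
      proof -
        have "\<bar>t / h\<bar> \<le> R / h" using that h by (simp add: abs_divide divide_right_mono)
        then show ?thesis unfolding N_def by (simp, linarith)
      qed
      moreover have "\<bar>fst x\<bar> \<le> R" "\<bar>snd x\<bar> \<le> R" using subsetD[OF A(3) x] by (auto simp: mem_Times_iff)
      ultimately have "(\<lfloor>fst x / h\<rfloor>, \<lfloor>snd x / h\<rfloor>) \<in> I" by (simp add: I_def)
      moreover have "x \<in> cell (\<lfloor>fst x / h\<rfloor>, \<lfloor>snd x / h\<rfloor>)"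
        by (simp add: cell_def mem_Times_iff floor_cell del: atLeastLessThan_iff)
      ultimately show "x \<in> (\<Union>z\<in>I. A \<inter> cell z)" using x by blast
    qed
  qed auto
  have cellm: "A \<inter> cell z \<in> sets borel" for z
    unfolding cell_def using A(1) by (intro sets.Int borel_Times) auto
  have "\<forall>k. \<exists>C. 2 \<le> k \<longrightarrow> vdC_const k C" using van_der_Corput by blast
  then obtain Cv where Cv: "\<And>k. 2 \<le> k \<Longrightarrow> vdC_const k (Cv k)" by metis
  define Cm where "Cm = (\<Sum>k\<in>{2..<p}. Cv k)"
  have Cv0: "0 \<le> Cv k" if "2 \<le> k" for k using Cv[OF that] by (simp add: vdC_const_def)
  have Cm: "Cv k \<le> Cm" if "k \<in> {2..<p}" for k
    unfolding Cm_def using that Cv0 by (intro member_le_sum) auto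
  have Cm0: "0 \<le> Cm" unfolding Cm_def by (intro sum_nonneg Cv0) auto
  define \<gamma> where "\<gamma> = 1 / real (p - 1)"
  have \<gamma>: "0 < \<gamma>" using p by (simp add: \<gamma>_def)
  have piece: "norm (LINT x:A \<inter> cell z|lborel. osc \<phi> \<xi>1 \<xi>2 x) \<le> 4 * R * Cm * (norm \<xi>2 * \<eta>) powr (- \<gamma>)"
    if \<xi>2: "\<xi>2 \<noteq> 0" and big: "1 \<le> norm \<xi>2 * \<eta>" for z \<xi>1 \<xi>2
  proof (cases "A \<inter> cell z = {}")
    case True
    then show ?thesis using R Cm0 by (simp add: set_lebesgue_integral_def)
  next
    case False
    then obtain x0 where x0: "x0 \<in> A" "x0 \<in> cell z" by blast
    define \<zeta> where "\<zeta> = \<xi>2 /\<^sub>R norm \<xi>2"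
    have "\<zeta> \<in> sphere 0 1" using \<xi>2 by (simp add: \<zeta>_def)
    from nd[OF subsetD[OF AK x0(1)] this] obtain i \<tau> where i: "i \<in> E \<times> {2..<p}" and \<tau>: "\<bar>\<tau>\<bar> = 1" and low: "\<And>y. y \<in> K \<Longrightarrow> dist x0 y < r \<Longrightarrow>
        \<eta> \<le> \<tau> * (fst \<zeta> * (Dd (fst i) ^^ snd i) (\<lambda>x. fst (\<phi> x)) y + snd \<zeta> * (Dd (fst i) ^^ snd i) (\<lambda>x. snd (\<phi> x)) y)"
      by blast
    define \<epsilon> where "\<epsilon> = fst i"
    define k where "k = snd i"
    note low = low[folded \<epsilon>_def k_def]
    have ek: "\<epsilon> \<in> E" "k \<in> {2..<p}" using i by (auto simp: \<epsilon>_def k_def)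
    have near: "dist x0 y \<le> r / 2" if "y \<in> cell z" for y
    proof -
      have "\<bar>fst x0 - fst y\<bar> \<le> h" "\<bar>snd x0 - snd y\<bar> \<le> h"
        using that x0(2) by (auto simp: cell_def mem_Times_iff algebra_simps)
      moreover have "dist x0 y \<le> \<bar>fst x0 - fst y\<bar> + \<bar>snd x0 - snd y\<bar>"
        using norm_Pair_le[of "fst x0 - fst y" "snd x0 - snd y"] by (simp add: dist_norm minus_prod_def)
      ultimately show ?thesis by (simp add: h_def)
    qed
    have "norm (LINT x:A \<inter> cell z|lborel. osc \<phi> \<xi>1 \<xi>2 x) \<le> 4 * R * (Cv k * (norm \<xi>2 * \<eta>) powr (- 1 / real k))"
    proof (rule osc_piece_bound[OF an cellm _ _ _ _ _ _ _ Cv \<tau>])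
      show "closure (A \<inter> cell z) \<subseteq> U" using A(2) closure_mono[of "A \<inter> cell z" A] by auto
      show "A \<inter> cell z \<subseteq> {-R..R} \<times> {-R..R}" using A(3) by auto
      show "0 \<le> \<epsilon>" "\<epsilon> \<le> 1" "0 \<le> R" "2 \<le> k" "2 \<le> k" "0 < norm \<xi>2 * \<eta>"
        using E(2)[OF ek(1)] R ek \<xi>2 \<eta> by auto
      show "is_interval {u. (y + \<epsilon> * u, u) \<in> A \<inter> cell z}" for y
      proof -
        have "is_interval {u. (y + \<epsilon> * u, u) \<in> cell z}"
          unfolding is_interval_1
        proof (intro ballI allI impI)
          fix a b x assume a: "a \<in> {u. (y + \<epsilon> * u, u) \<in> cell z}" and b: "b \<in> {u. (y + \<epsilon> * u, u) \<in> cell z}" and x: "a \<le> x \<and> x \<le> b"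
          have "\<epsilon> * a \<le> \<epsilon> * x" "\<epsilon> * x \<le> \<epsilon> * b" using x E(2)[OF ek(1)] by (auto intro: mult_left_mono)
          then show "x \<in> {u. (y + \<epsilon> * u, u) \<in> cell z}" using a b x by (auto simp: cell_def)
        qed
        moreover have "{u. (y + \<epsilon> * u, u) \<in> A \<inter> cell z} = {u. (y + \<epsilon> * u, u) \<in> A} \<inter> {u. (y + \<epsilon> * u, u) \<in> cell z}" by auto
        ultimately show ?thesis using is_interval_Int[OF sect[OF ek(1), of y]] by simp
      qed
      fix x assume x: "x \<in> closure (A \<inter> cell z)"
      have "closure (A \<inter> cell z) \<subseteq> cball x0 (r / 2)" by (rule closure_minimal) (use near in auto)
      then have "dist x0 x < r" using x r by auto
      moreover have "x \<in> K" using x closure_mono[of "A \<inter> cell z" A] by (auto simp: K_def)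
      ultimately have "norm \<xi>2 * \<eta> \<le> norm \<xi>2 * (\<tau> * (fst \<zeta> * (Dd \<epsilon> ^^ k) (\<lambda>x. fst (\<phi> x)) x + snd \<zeta> * (Dd \<epsilon> ^^ k) (\<lambda>x. snd (\<phi> x)) x))"
        by (intro mult_left_mono low) auto
      also have "\<dots> = \<tau> * (fst \<xi>2 * (Dd \<epsilon> ^^ k) (\<lambda>x. fst (\<phi> x)) x + snd \<xi>2 * (Dd \<epsilon> ^^ k) (\<lambda>x. snd (\<phi> x)) x)"
        using \<xi>2 by (simp add: \<zeta>_def field_simps)
      finally show "norm \<xi>2 * \<eta> \<le> \<tau> * (fst \<xi>2 * (Dd \<epsilon> ^^ k) (\<lambda>x. fst (\<phi> x)) x + snd \<xi>2 * (Dd \<epsilon> ^^ k) (\<lambda>x. snd (\<phi> x)) x)" .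
    qed
    \<comment> \<open>The base is at least 1, so the exponent -1/k may be raised to -1/(p -
      1).\<close>
    also have "\<dots> \<le> 4 * R * (Cm * (norm \<xi>2 * \<eta>) powr (- \<gamma>))"
    proof (intro mult_left_mono mult_mono Cm ek powr_mono big)
      have "real k \<le> real (p - 1)" "0 < real k" using ek(2) by auto
      then have "1 / real (p - 1) \<le> 1 / real k" by (intro divide_left_mono mult_pos_pos) auto
      then show "- 1 / real k \<le> - \<gamma>" by (simp add: \<gamma>_def)
    qed (use R Cm0 in auto)
    finally show ?thesis by (simp add: mult_ac)
  qed
  define V where "V = measure lborel A"
  \<comment> \<open>\<open>V\<close> covers the case |\<xi>2| \<eta> < 1, where the measure of
    \<open>A\<close> is a sufficient bound because the power is at least 1; the summand 1 makes
    \<open>C0\<close> positive.\<close>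
  define C0 where "C0 = real (card I) * (4 * R * Cm) + V + 1"
  have C0: "0 < C0" using R Cm0 by (simp add: C0_def V_def add_nonneg_pos)
  show thesis
  proof (rule that[of "C0 * \<eta> powr (- \<gamma>)"])
    show "0 < C0 * \<eta> powr (- \<gamma>)" using C0 \<eta> by simp
    fix \<xi>1 \<xi>2 :: "real \<times> real" assume \<xi>2: "\<xi>2 \<noteq> 0"
    have pos: "0 < norm \<xi>2 * \<eta>" using \<xi>2 \<eta> by simp
    have "norm (LINT x:A|lborel. osc \<phi> \<xi>1 \<xi>2 x) \<le> C0 * (norm \<xi>2 * \<eta>) powr (- \<gamma>)"
    proof (cases "1 \<le> norm \<xi>2 * \<eta>")
      case True
      have disj: "z = z'" if "x \<in> cell z" "x \<in> cell z'" for x z z'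
        using that by (simp add: cell_def mem_Times_iff floor_cell prod_eq_iff del: atLeastLessThan_iff)
      have "(LINT x:A|lborel. osc \<phi> \<xi>1 \<xi>2 x) = (LINT x:(\<Union>z\<in>I. A \<inter> cell z)|lborel. osc \<phi> \<xi>1 \<xi>2 x)"
        using AU by simp
      also have "\<dots> = (\<Sum>z\<in>I. LINT x:A \<inter> cell z|lborel. osc \<phi> \<xi>1 \<xi>2 x)"
      proof (rule set_integral_finite_UN_AE[OF fin])
        show "AE x in lborel. x \<in> A \<inter> cell i \<and> x \<in> A \<inter> cell j \<longrightarrow> i = j" for i j
          using disj by (intro AE_I2) blast
        show "A \<inter> cell i \<in> sets lborel" for i using cellm by simp
        show "set_integrable lborel (A \<inter> cell i) (osc \<phi> \<xi>1 \<xi>2)" for i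
          by (rule set_integrable_osc[OF continuous_on_subset[OF c\<phi>A] cellm]) (use A(3) in auto)
      qed
      also have "norm \<dots> \<le> (\<Sum>z\<in>I. 4 * R * Cm * (norm \<xi>2 * \<eta>) powr (- \<gamma>))"
        by (rule sum_norm_le) (use piece[OF \<xi>2 True] in auto)
      also have "\<dots> = real (card I) * (4 * R * Cm) * (norm \<xi>2 * \<eta>) powr (- \<gamma>)" by simp
      also have "\<dots> \<le> C0 * (norm \<xi>2 * \<eta>) powr (- \<gamma>)"
        by (intro mult_right_mono) (auto simp: C0_def V_def)
      finally show ?thesis .
    next
      case False
      have "norm (LINT x:A|lborel. osc \<phi> \<xi>1 \<xi>2 x) \<le> V"
        unfolding V_def by (rule norm_set_integral_osc_le[OF c\<phi>A A(1,3)])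
      also have "\<dots> \<le> C0 * 1" using R Cm0 by (simp add: C0_def)
      also have "1 \<le> (norm \<xi>2 * \<eta>) powr (- \<gamma>)"
      proof -
        have "(norm \<xi>2 * \<eta>) powr \<gamma> \<le> 1" using False pos \<gamma> by (intro powr_le1) auto
        then show ?thesis using \<xi>2 \<eta> by (simp add: powr_minus one_le_inverse_iff)
      qed
      finally show ?thesis using C0 by simp
    qed
    also have "\<dots> = C0 * \<eta> powr (- \<gamma>) * norm \<xi>2 powr (- 1 / real (p - 1))"
      using \<eta> by (simp add: powr_mult \<gamma>_def mult_ac)
    finally show "norm (LINT x:A|lborel. osc \<phi> \<xi>1 \<xi>2 x) \<le> C0 * \<eta> powr (- \<gamma>) * norm \<xi>2 powr (- 1 / real (p - 1))" .
  qed
qed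

section \<open>Homogeneous sectors and Euler identities\<close>

text \<open>At the exponent \<open>\<alpha> / m\<close> the recursion is exactly scale invariant, so a plain induction would let the
  constant grow; the bound proved by induction carries a negative term of the faster decay
  \<open>- \<gamma>\<close> that absorbs the error of each step.\<close>
lemma dyadic_bootstrap:
  fixes M :: "'a \<Rightarrow> real \<times> real \<Rightarrow> real" and S :: "'a \<Rightarrow> 'a"
  assumes C: "0 \<le> C" and M0: "\<And>\<xi>1 \<xi>2. M \<xi>1 \<xi>2 \<le> M0"
    and m: "0 < m" and \<alpha>: "0 < \<alpha>" and \<gamma>: "\<alpha> / m < \<gamma>"
    and step: "\<And>\<xi>1 \<xi>2. \<xi>2 \<noteq> 0 \<Longrightarrow> M \<xi>1 \<xi>2 \<le> C * norm \<xi>2 powr (- \<gamma>)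
       + 2 powr (- \<alpha>) * M (S \<xi>1) (2 powr (- m) *\<^sub>R \<xi>2)"
  shows "\<exists>B>0. \<forall>\<xi>1 \<xi>2. \<xi>2 \<noteq> 0 \<longrightarrow> M \<xi>1 \<xi>2 \<le> B * norm \<xi>2 powr (- \<alpha> / m)"
proof -
  define \<rho> where "\<rho> = \<alpha> / m"
  have \<rho>: "0 < \<rho>" "\<rho> < \<gamma>" "\<rho> * m = \<alpha>" using m \<alpha> \<gamma> by (auto simp: \<rho>_def)
  \<comment> \<open>One step divides |\<xi>2| by \<open>2 powr m\<close>. The self-similar term then
    reproduces itself exactly, while the term of decay \<gamma> is multiplied by q. \<open>E\<close>
    solves C + E = E q, so this growth of the negative term pays for the error C of the
    step.\<close>
  define q where "q = 2 powr (m * (\<gamma> - \<rho>))"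
  have q: "1 < q" unfolding q_def using m \<rho> by simp
  define E where "E = C / (q - 1)"
  have E: "0 \<le> E" "C + E = E * q" using C q by (auto simp: E_def field_simps)
  \<comment> \<open>On the initial shell, with |\<xi>2| between \<open>2 powr (- m)\<close> and 1,
    the quotient of the powers with exponents -\<gamma> and -\<rho> is at most q; the summand
    \<open>E * q\<close> therefore offsets the negative term.\<close>
  define B where "B = \<bar>M0\<bar> + E * q + 1"
  have B: "0 < B" using E q by (simp add: B_def add_nonneg_pos)
  \<comment> \<open>The range begins at \<open>2 powr (- m)\<close> rather than 1 because a
    frequency of norm at least 1 may land there after one step.\<close>
  have key: "M \<xi>1 \<xi>2 \<le> norm \<xi>2 powr (- \<rho>) * B - E * norm \<xi>2 powr (- \<gamma>)"
    if "2 powr (- m) \<le> norm \<xi>2" "norm \<xi>2 \<le> 2 powr (m * real N)" for N \<xi>1 \<xi>2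
    using that
  proof (induction N arbitrary: \<xi>1 \<xi>2)
    case 0
    have n: "0 < norm \<xi>2" "norm \<xi>2 \<le> 1" using 0 by (auto intro: less_le_trans[of 0 "2 powr (- m)"])
    have "norm \<xi>2 powr (- \<gamma>) = norm \<xi>2 powr (- \<rho>) * norm \<xi>2 powr (- (\<gamma> - \<rho>))"
      by (simp add: powr_add[symmetric])
    also have "norm \<xi>2 powr (- (\<gamma> - \<rho>)) \<le> (2 powr (- m)) powr (- (\<gamma> - \<rho>))"
      using 0(1) n \<rho> by (intro powr_mono2') auto
    also have "(2 powr (- m)) powr (- (\<gamma> - \<rho>)) = q" by (simp add: powr_powr q_def algebra_simps)
    finally have "E * norm \<xi>2 powr (- \<gamma>) \<le> E * (norm \<xi>2 powr (- \<rho>) * q)"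
      using E by (simp add: mult_left_mono)
    moreover have "1 \<le> norm \<xi>2 powr (- \<rho>)"
      using n \<rho> powr_le1[of \<rho> "norm \<xi>2"] by (simp add: powr_minus one_le_inverse_iff)
    then have "\<bar>M0\<bar> * 1 \<le> \<bar>M0\<bar> * norm \<xi>2 powr (- \<rho>)" by (intro mult_left_mono) auto
    moreover have "0 \<le> norm \<xi>2 powr (- \<rho>)" by simp
    moreover have "norm \<xi>2 powr (- \<rho>) * B = \<bar>M0\<bar> * norm \<xi>2 powr (- \<rho>)
        + E * (norm \<xi>2 powr (- \<rho>) * q) + norm \<xi>2 powr (- \<rho>)"
      by (simp add: B_def algebra_simps)
    moreover have "M0 \<le> \<bar>M0\<bar>" by simp
    ultimately show ?case using M0[of \<xi>1 \<xi>2] by linarith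
  next
    case (Suc N)
    show ?case
    proof (cases "norm \<xi>2 \<le> 2 powr (m * real N)")
      case True
      then show ?thesis using Suc by blast
    next
      case False
      then have n: "1 \<le> norm \<xi>2" using ge_one_powr_ge_zero[of 2 "m * real N"] m by auto
      let ?\<eta> = "2 powr (- m) *\<^sub>R \<xi>2"
      have ne: "norm ?\<eta> = 2 powr (- m) * norm \<xi>2" by simp
      have "norm ?\<eta> \<le> 2 powr (- m) * 2 powr (m * real (Suc N))"
        unfolding ne using Suc.prems by (intro mult_left_mono) auto
      also have "\<dots> = 2 powr (m * real N)" by (simp add: powr_add[symmetric] algebra_simps)
      finally have "M (S \<xi>1) ?\<eta> \<le> norm ?\<eta> powr (- \<rho>) * B - E * norm ?\<eta> powr (- \<gamma>)"
        using n by (intro Suc.IH) (simp_all only: ne, simp)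
      also have "norm ?\<eta> powr (- \<rho>) = 2 powr \<alpha> * norm \<xi>2 powr (- \<rho>)"
        unfolding ne using \<rho> by (simp add: powr_mult powr_powr mult.commute)
      also have "norm ?\<eta> powr (- \<gamma>) = 2 powr \<alpha> * (q * norm \<xi>2 powr (- \<gamma>))"
        unfolding ne q_def using \<rho> by (simp add: powr_mult powr_powr powr_add[symmetric] algebra_simps)
      finally have "2 powr (- \<alpha>) * M (S \<xi>1) ?\<eta> \<le> 2 powr (- \<alpha>) * (2 powr \<alpha> * (norm \<xi>2 powr (- \<rho>) * B - E * q * norm \<xi>2 powr (- \<gamma>)))"
        by (intro mult_left_mono) (auto simp: algebra_simps)
      also have "\<dots> = norm \<xi>2 powr (- \<rho>) * B - E * q * norm \<xi>2 powr (- \<gamma>)"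
        by (simp add: powr_minus)
      finally have le: "2 powr (- \<alpha>) * M (S \<xi>1) ?\<eta> \<le> norm \<xi>2 powr (- \<rho>) * B - (C + E) * norm \<xi>2 powr (- \<gamma>)"
        by (simp add: E)
      have "\<xi>2 \<noteq> 0" using n by auto
      from step[OF this, of \<xi>1] show ?thesis using le
        unfolding distrib_right by linarith
    qed
  qed
  have "M \<xi>1 \<xi>2 \<le> B * norm \<xi>2 powr (- \<rho>)" if "\<xi>2 \<noteq> 0" for \<xi>1 \<xi>2
  proof (cases "2 powr (- m) \<le> norm \<xi>2")
    case True
    obtain N :: nat where "norm \<xi>2 < (2 powr m) ^ N"
      using real_arch_pow[of "2 powr m" "norm \<xi>2"] m by auto
    then have "norm \<xi>2 \<le> 2 powr (m * real N)" by (simp add: powr_powr[symmetric] powr_realpow)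
    then have "M \<xi>1 \<xi>2 \<le> norm \<xi>2 powr (- \<rho>) * B - E * norm \<xi>2 powr (- \<gamma>)"
      by (rule key[OF True])
    moreover have "0 \<le> E * norm \<xi>2 powr (- \<gamma>)" using E by simp
    ultimately show ?thesis by (simp add: mult.commute)
  next
    case False
    moreover have "2 powr (- m) \<le> 1" using m by (simp add: powr_minus inverse_le_1_iff ge_one_powr_ge_zero)
    ultimately have n: "0 < norm \<xi>2" "norm \<xi>2 \<le> 1" using that by auto
    have "0 \<le> E * q" using E q by simp
    then have "M \<xi>1 \<xi>2 \<le> B * 1" using M0[of \<xi>1 \<xi>2] by (simp add: B_def)
    also have "\<dots> \<le> B * norm \<xi>2 powr (- \<rho>)"
      using n \<rho> B powr_le1[of \<rho> "norm \<xi>2"] that by (intro mult_left_mono) (auto simp: powr_minus one_le_inverse_iff)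
    finally show ?thesis .
  qed
  then show ?thesis using B by (auto simp: \<rho>_def)
qed

section \<open>Sectors in Cartesian coordinates\<close>

lemma cone_iff:
  assumes "0 < \<alpha>1"
  shows "x \<in> cone \<alpha>1 \<alpha>2 a b \<longleftrightarrow> 0 < fst x \<and> a * fst x powr (\<alpha>2 / \<alpha>1) < snd x \<and> snd x < b * fst x powr (\<alpha>2 / \<alpha>1)"
proof
  assume "x \<in> cone \<alpha>1 \<alpha>2 a b"
  then obtain t s where "x = dil \<alpha>1 \<alpha>2 t (1, s)" "a < s" "s < b" "0 < t" unfolding cone_def by blast
  then show "0 < fst x \<and> a * fst x powr (\<alpha>2 / \<alpha>1) < snd x \<and> snd x < b * fst x powr (\<alpha>2 / \<alpha>1)"
    using assms by (simp add: dil_def powr_powr mult.commute)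
next
  assume r: "0 < fst x \<and> a * fst x powr (\<alpha>2 / \<alpha>1) < snd x \<and> snd x < b * fst x powr (\<alpha>2 / \<alpha>1)"
  \<comment> \<open>The orbit of x under the dilations meets the line x1 = 1 at height s, and t is
    the parameter leading back to x.\<close>
  define t where "t = fst x powr (1 / \<alpha>1)"
  define s where "s = snd x / fst x powr (\<alpha>2 / \<alpha>1)"
  have "x = dil \<alpha>1 \<alpha>2 t (1, s)"
    using r assms by (simp add: dil_def t_def s_def powr_powr prod_eq_iff)
  moreover have "a < s" "s < b" "0 < t" using r by (auto simp: s_def t_def field_simps)
  ultimately show "x \<in> cone \<alpha>1 \<alpha>2 a b" unfolding cone_def by blast
qed

lemma cone1_iff:
  assumes "0 < \<alpha>1"
  shows "x \<in> cone1 \<alpha>1 \<alpha>2 a b \<longleftrightarrow> x \<in> cone \<alpha>1 \<alpha>2 a b \<and> fst x < 1"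
proof -
  have "t powr \<alpha>1 < 1 \<longleftrightarrow> t < 1" if "0 < t" for t
    using powr_less_cancel_iff[of t \<alpha>1 0] assms that powr_less_mono2[of \<alpha>1 t 1] powr_mono2[of \<alpha>1 1 t] by force
  then show ?thesis unfolding cone_def cone1_def by (auto simp: dil_def) blast+
qed

lemma open_cone:
  assumes "0 < \<alpha>1"
  shows "open (cone \<alpha>1 \<alpha>2 a b)"
proof -
  let ?H = "{x :: real \<times> real. 0 < fst x}"
  have H: "open ?H" by (intro open_Collect_less continuous_intros)
  have c: "continuous_on ?H (\<lambda>x. snd x - a * fst x powr (\<alpha>2 / \<alpha>1))" for a
    by (intro continuous_intros) auto
  have "cone \<alpha>1 \<alpha>2 a b = (?H \<inter> (\<lambda>x. snd x - a * fst x powr (\<alpha>2 / \<alpha>1)) -` {0<..})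
      \<inter> (?H \<inter> (\<lambda>x. snd x - b * fst x powr (\<alpha>2 / \<alpha>1)) -` {..<0})"
    by (auto simp: cone_iff[OF assms])
  also have "open \<dots>"
    by (intro open_Int continuous_open_preimage c H) auto
  finally show ?thesis .
qed

section \<open>Euler's relations for weighted homogeneity\<close>

lemma euler_identity:
  fixes f :: "real \<times> real \<Rightarrow> real"
  assumes an: "real_analytic2_on f U" and x: "x \<in> U"
    and hom: "\<And>t. 0 < t \<Longrightarrow> f (dil \<alpha>1 \<alpha>2 t x) = t powr m * f x"
  shows "\<alpha>1 * fst x * pd1 f x + \<alpha>2 * snd x * pd2 f x = m * f x"
proof -
  have d1: "dil \<alpha>1 \<alpha>2 1 x = x" by (simp add: dil_def)
  have "((\<lambda>t. dil \<alpha>1 \<alpha>2 t x) has_derivative (\<lambda>h. (\<alpha>1 * fst x * h, \<alpha>2 * snd x * h))) (at 1)"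
    unfolding dil_def by (intro has_derivative_Pair) (auto intro!: derivative_eq_intros)
  moreover have "(f has_derivative (\<lambda>v. pd1 f x * fst v + pd2 f x * snd v)) (at (dil \<alpha>1 \<alpha>2 1 x))"
    unfolding d1 by (rule real_analytic2_has_derivative[OF an x])
  ultimately have "((\<lambda>t. f (dil \<alpha>1 \<alpha>2 t x)) has_derivative
      (\<lambda>h. pd1 f x * fst (\<alpha>1 * fst x * h, \<alpha>2 * snd x * h) + pd2 f x * snd (\<alpha>1 * fst x * h, \<alpha>2 * snd x * h))) (at 1)"
    by (rule has_derivative_compose)
  then have "((\<lambda>t. f (dil \<alpha>1 \<alpha>2 t x)) has_real_derivative \<alpha>1 * fst x * pd1 f x + \<alpha>2 * snd x * pd2 f x) (at 1)"
    unfolding has_field_derivative_def by (rule has_derivative_eq_rhs) (auto simp: algebra_simps)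
  then have "((\<lambda>t. t powr m * f x) has_real_derivative \<alpha>1 * fst x * pd1 f x + \<alpha>2 * snd x * pd2 f x) (at 1)"
    by (rule has_field_derivative_transform_within_open[where S = "{0<..}"]) (auto simp: hom)
  moreover have "((\<lambda>t. t powr m * f x) has_real_derivative m * f x) (at 1)"
    by (auto intro!: derivative_eq_intros)
  ultimately show ?thesis by (rule DERIV_unique)
qed

lemma real_analytic2_DERIV_pd2:
  assumes "real_analytic2_on f U" "(x, y) \<in> U"
  shows "((\<lambda>t. f (x, t)) has_real_derivative pd2 f (x, y)) (at y)"
  using real_analytic2_DERIV_Dd[where \<epsilon> = 0 and y = x and u = y, OF assms(1)] assms(2)
  by (simp add: Dd_0)

text \<open>Euler's relation holds on an open set and may be differentiated in either variable. The
  mixed derivatives are written in one order so that both identities share an entry of the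
  Hessian.\<close>

lemma euler_identity_deriv:
  fixes f :: "real \<times> real \<Rightarrow> real"
  assumes an: "real_analytic2_on f U" and U: "open U" and x: "x \<in> U"
    and hom: "\<And>x t. x \<in> U \<Longrightarrow> 0 < t \<Longrightarrow> f (dil \<alpha>1 \<alpha>2 t x) = t powr m * f x"
  shows "\<alpha>1 * fst x * pd1 (pd1 f) x + \<alpha>2 * snd x * pd1 (pd2 f) x = (m - \<alpha>1) * pd1 f x"
    and "\<alpha>1 * fst x * pd1 (pd2 f) x + \<alpha>2 * snd x * pd2 (pd2 f) x = (m - \<alpha>2) * pd2 f x"
proof -
  obtain u v where uv: "x = (u, v)" by (cases x)
  have e: "\<alpha>1 * p * pd1 f (p, q) + \<alpha>2 * q * pd2 f (p, q) = m * f (p, q)" if "(p, q) \<in> U" for p q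
    using euler_identity[OF an that hom[OF that]] by simp
  note an1 = real_analytic2_on_pd1[OF an] and an2 = real_analytic2_on_pd2[OF an]
  have xU: "(u, v) \<in> U" using x uv by simp
  have "open ((\<lambda>p. (p, v)) -` U)" "open ((\<lambda>q. (u, q)) -` U)"
    by (intro open_vimage U continuous_intros)+
  then have S1: "open {p. (p, v) \<in> U}" and S2: "open {q. (u, q) \<in> U}"
    by (simp_all only: vimage_def)
  have "((\<lambda>p. \<alpha>1 * p * pd1 f (p, v) + \<alpha>2 * v * pd2 f (p, v)) has_real_derivative
      \<alpha>1 * pd1 f x + \<alpha>1 * u * pd1 (pd1 f) x + \<alpha>2 * v * pd1 (pd2 f) x) (at u)"
    unfolding uv
    by (rule derivative_eq_intros real_analytic2_DERIV_pd1[OF an1 xU] real_analytic2_DERIV_pd1[OF an2 xU] refl | simp add: algebra_simps)+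
  then have "((\<lambda>p. m * f (p, v)) has_real_derivative
      \<alpha>1 * pd1 f x + \<alpha>1 * u * pd1 (pd1 f) x + \<alpha>2 * v * pd1 (pd2 f) x) (at u)"
    by (rule has_field_derivative_transform_within_open[OF _ S1]) (use xU e in auto)
  moreover have "((\<lambda>p. m * f (p, v)) has_real_derivative m * pd1 f x) (at u)"
    unfolding uv by (intro DERIV_cmult real_analytic2_DERIV_pd1[OF an xU])
  ultimately have "\<alpha>1 * pd1 f x + \<alpha>1 * u * pd1 (pd1 f) x + \<alpha>2 * v * pd1 (pd2 f) x = m * pd1 f x"
    by (rule DERIV_unique)
  then show "\<alpha>1 * fst x * pd1 (pd1 f) x + \<alpha>2 * snd x * pd1 (pd2 f) x = (m - \<alpha>1) * pd1 f x"
    by (simp add: uv algebra_simps)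
  have "((\<lambda>q. \<alpha>1 * u * pd1 f (u, q) + \<alpha>2 * q * pd2 f (u, q)) has_real_derivative
      \<alpha>1 * u * pd2 (pd1 f) x + \<alpha>2 * pd2 f x + \<alpha>2 * v * pd2 (pd2 f) x) (at v)"
    unfolding uv
    by (rule derivative_eq_intros real_analytic2_DERIV_pd2[OF an1 xU] real_analytic2_DERIV_pd2[OF an2 xU] refl | simp add: algebra_simps)+
  then have "((\<lambda>q. m * f (u, q)) has_real_derivative
      \<alpha>1 * u * pd2 (pd1 f) x + \<alpha>2 * pd2 f x + \<alpha>2 * v * pd2 (pd2 f) x) (at v)"
    by (rule has_field_derivative_transform_within_open[OF _ S2]) (use xU e in auto)
  moreover have "((\<lambda>q. m * f (u, q)) has_real_derivative m * pd2 f x) (at v)"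
    unfolding uv by (intro DERIV_cmult real_analytic2_DERIV_pd2[OF an xU])
  ultimately have "\<alpha>1 * u * pd2 (pd1 f) x + \<alpha>2 * pd2 f x + \<alpha>2 * v * pd2 (pd2 f) x = m * pd2 f x"
    by (rule DERIV_unique)
  then show "\<alpha>1 * fst x * pd1 (pd2 f) x + \<alpha>2 * snd x * pd2 (pd2 f) x = (m - \<alpha>2) * pd2 f x"
    using real_analytic2_pd_commute[OF an x] by (simp add: uv algebra_simps)
qed

text \<open>Downward induction on the order: the mean value inequality turns the bound on F (k + 1)
  into one on the increment of F k, and F k vanishes at v0.\<close>

lemma flat_bound:
  fixes F :: "nat \<Rightarrow> real \<Rightarrow> real"
  assumes d: "\<And>k v. k < p \<Longrightarrow> \<bar>v - v0\<bar> \<le> s \<Longrightarrow> (F k has_real_derivative F (Suc k) v) (at v)"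
    and z: "\<And>k. k < p \<Longrightarrow> F k v0 = 0"
    and M: "\<And>v. \<bar>v - v0\<bar> \<le> s \<Longrightarrow> \<bar>F p v\<bar> \<le> M"
    and k: "k \<le> p" and v: "\<bar>v - v0\<bar> \<le> s"
  shows "\<bar>F k v\<bar> \<le> M * \<bar>v - v0\<bar> ^ (p - k)"
  using k v
proof (induction arbitrary: v rule: inc_induct)
  case base
  then show ?case using M by simp
next
  case (step k)
  define r where "r = \<bar>v - v0\<bar>"
  have "\<bar>v0 - v0\<bar> \<le> s" using step.prems abs_ge_zero[of "v - v0"] by simp
  then have M0: "0 \<le> M" using M abs_ge_zero[of "F p v0"] by (meson order_trans)
  have "norm (F k v - F k v0) \<le> M * r ^ (p - Suc k) * norm (v - v0)"
  proof (rule field_differentiable_bound[where S = "cball v0 r" and f' = "F (Suc k)"])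
    fix w assume "w \<in> cball v0 r"
    then have w: "\<bar>w - v0\<bar> \<le> r" by (simp add: dist_real_def abs_minus_commute)
    then have ws: "\<bar>w - v0\<bar> \<le> s" using step.prems by (simp add: r_def)
    show "(F k has_field_derivative F (Suc k) w) (at w within cball v0 r)"
      by (rule has_field_derivative_at_within[OF d[OF step.hyps(2) ws]])
    have "\<bar>F (Suc k) w\<bar> \<le> M * \<bar>w - v0\<bar> ^ (p - Suc k)" by (rule step.IH[OF ws])
    also have "\<dots> \<le> M * r ^ (p - Suc k)" using w M0 by (intro mult_left_mono power_mono) auto
    finally show "norm (F (Suc k) w) \<le> M * r ^ (p - Suc k)" by simp
  qed (auto simp: r_def dist_real_def abs_minus_commute)
  also have "\<dots> = M * r ^ (p - k)"
  proof -
    have "p - k = Suc (p - Suc k)" using step.hyps by simp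
    then show ?thesis by (simp add: r_def)
  qed
  finally show ?case using z[of k] step.hyps by (simp add: r_def)
qed

section \<open>Degeneration of the Hessian\<close>

text \<open>Elimination of p1, h11 and h12 by Euler's relations. Only the phase and its
  x2-derivatives remain, so flatness along a vertical line controls the full determinant. The square
  of h22 cancels; its order 2p - 4 would be one too low.\<close>

lemma hessian_det_identity:
  fixes \<alpha>1 \<alpha>2 m x1 x2 P p1 p2 h11 h12 h22 :: real
  assumes "\<alpha>1 * x1 * p1 + \<alpha>2 * x2 * p2 = m * P"
    and "\<alpha>1 * x1 * h11 + \<alpha>2 * x2 * h12 = (m - \<alpha>1) * p1"
    and "\<alpha>1 * x1 * h12 + \<alpha>2 * x2 * h22 = (m - \<alpha>2) * p2"
  shows "(\<alpha>1 * x1)\<^sup>2 * (h11 * h22 - h12 * h12) =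
    m * (m - \<alpha>1) * P * h22 + \<alpha>2 * (\<alpha>1 - \<alpha>2) * x2 * p2 * h22 - (m - \<alpha>2)\<^sup>2 * p2\<^sup>2"
proof -
  define a where "a = \<alpha>1 * x1"
  define b where "b = \<alpha>2 * x2"
  have 1: "a * h12 = (m - \<alpha>2) * p2 - b * h22" "a * p1 = m * P - b * p2" "a * h11 = (m - \<alpha>1) * p1 - b * h12"
    using assms by (simp_all add: a_def b_def)
  have "a\<^sup>2 * (h11 * h22 - h12 * h12) = h22 * (a * (a * h11)) - (a * h12)\<^sup>2"
    by (simp add: power2_eq_square algebra_simps)
  also have "a * (a * h11) = (m - \<alpha>1) * (a * p1) - b * (a * h12)"
    unfolding 1(3) by (simp add: algebra_simps)
  finally have "a\<^sup>2 * (h11 * h22 - h12 * h12) = h22 * ((m - \<alpha>1) * (m * P - b * p2) - b * ((m - \<alpha>2) * p2 - b * h22))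
      - ((m - \<alpha>2) * p2 - b * h22)\<^sup>2"
    unfolding 1(1,2) .
  then show ?thesis unfolding a_def[symmetric] by (simp add: b_def power2_eq_square algebra_simps)
qed

lemma Qform_eq:
  assumes "real_analytic2_on (\<lambda>x. fst (\<phi> x)) U" "real_analytic2_on (\<lambda>x. snd (\<phi> x)) U" "x \<in> U"
  shows "Qform \<phi> x \<zeta> =
    (let H = (\<lambda>D. fst \<zeta> * D (\<lambda>x. fst (\<phi> x)) + snd \<zeta> * D (\<lambda>x. snd (\<phi> x)))
     in H (\<lambda>f. pd1 (pd1 f) x) * H (\<lambda>f. pd2 (pd2 f) x) - H (\<lambda>f. pd1 (pd2 f) x) * H (\<lambda>f. pd1 (pd2 f) x))"
  using real_analytic2_pd_commute[OF assms(1,3)] real_analytic2_pd_commute[OF assms(2,3)]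
  by (simp add: Qform_def Let_def)

lemma INF_Qform_le:
  assumes "\<zeta> \<in> sphere 0 1"
  shows "(INF \<zeta>\<in>sphere 0 1. \<bar>Qform \<phi> x \<zeta>\<bar>) \<le> \<bar>Qform \<phi> x \<zeta>\<bar>"
  using assms by (intro cINF_lower) (auto intro!: bdd_belowI2[of _ 0])

text \<open>A polynomial of degree at most two in the slope with the three zeros 0, e and 2e is
  zero.\<close>

lemma quadratic_zero_three:
  fixes e A B C :: real
  assumes "0 < e" "C = 0" "e\<^sup>2 * A + 2 * e * B + C = 0" "(2 * e)\<^sup>2 * A + 2 * (2 * e) * B + C = 0"
  shows "A = 0" "B = 0"
proof -
  have "e * (e * A + 2 * B) = 0" "2 * e * (2 * e * A + 2 * B) = 0"
    using assms by (auto simp: power2_eq_square algebra_simps)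
  then have "e * A + 2 * B = 0" "2 * e * A + 2 * B = 0" using assms(1) by auto
  then have "e * A = 0" "B = 0" by linarith+
  then show "A = 0" "B = 0" using assms(1) by auto
qed

text \<open>Divide by h^n and let h tend to 0. The explicit h is chosen to make the right-hand side
  at most A/2.\<close>

lemma power_gap_contradiction:
  fixes A B r :: real and n q :: nat
  assumes "0 < A" "0 < r" "n < q" and le: "\<And>h. 0 < h \<Longrightarrow> h < r \<Longrightarrow> A * h ^ n \<le> B * h ^ q"
  shows False
proof -
  have "A \<le> B * h" if h: "0 < h" "h < min r 1" for h
  proof -
    have 1: "A * h ^ n \<le> B * h ^ q" using le h by simp
    have q: "h ^ q = h ^ n * h ^ (q - n)" using assms(3) by (simp add: power_add[symmetric])
    have A: "A \<le> B * h ^ (q - n)" using 1 h unfolding q by (simp add: mult.left_commute[of B])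
    moreover have "0 < h ^ (q - n)" using h by simp
    ultimately have "0 \<le> B" using assms(1) by (smt (verit) mult_nonpos_nonneg)
    moreover have "h ^ (q - n) \<le> h ^ 1" using h assms(3) by (intro power_decreasing) auto
    ultimately have "B * h ^ (q - n) \<le> B * h" by (simp add: mult_left_mono)
    then show ?thesis using A by simp
  qed
  note le' = this
  define h where "h = min (min r 1 / 2) (A / (2 * (\<bar>B\<bar> + 1)))"
  have h: "0 < h" "h < min r 1" "h \<le> A / (2 * (\<bar>B\<bar> + 1))" using assms by (auto simp: h_def)
  have "A \<le> B * h" by (rule le'[OF h(1,2)])
  also have "\<dots> \<le> (\<bar>B\<bar> + 1) * h" using h by (intro mult_right_mono) auto
  also have "\<dots> \<le> (\<bar>B\<bar> + 1) * (A / (2 * (\<bar>B\<bar> + 1)))" using h by (intro mult_left_mono) auto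
  also have "\<dots> = A / 2" using abs_ge_zero[of B] by (simp add: field_simps)
  finally show False using assms(1) by simp
qed

text \<open>If the three directions degenerate to all orders 2, ..., p - 1 at a point, Euler's relation makes
  the phase vanish to order p along the vertical line through it. In \<open>hessian_det_identity\<close> each product
  then has order at least 2 p - 3, which is what the bound on the exponents in (H4) excludes.\<close>
lemma Qform_flat_bound:
  fixes \<phi> :: "real \<times> real \<Rightarrow> real \<times> real"
  assumes an: "real_analytic2_on (\<lambda>x. fst (\<phi> x)) U" "real_analytic2_on (\<lambda>x. snd (\<phi> x)) U"
    and U: "open U" and x: "(u, v0) \<in> U" "0 < u"
    and \<alpha>: "0 < \<alpha>1" "0 < \<alpha>2" and m: "\<alpha>1 + \<alpha>2 < m" and p: "3 \<le> p" and e: "0 < e"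
    and hom: "\<And>x t. x \<in> U \<Longrightarrow> 0 < t \<Longrightarrow> \<phi> (dil \<alpha>1 \<alpha>2 t x) = t powr m *\<^sub>R \<phi> x"
    and z: "\<And>\<epsilon> k. \<epsilon> \<in> {0, e, 2 * e} \<Longrightarrow> k \<in> {2..<p} \<Longrightarrow>
        fst \<zeta> * (Dd \<epsilon> ^^ k) (\<lambda>x. fst (\<phi> x)) (u, v0) + snd \<zeta> * (Dd \<epsilon> ^^ k) (\<lambda>x. snd (\<phi> x)) (u, v0) = 0"
  shows "Qform \<phi> (u, v0) \<zeta> = 0"
    and "\<exists>s>0. \<exists>B. \<forall>v. \<bar>v - v0\<bar> \<le> s \<longrightarrow> \<bar>Qform \<phi> (u, v) \<zeta>\<bar> \<le> B * \<bar>v - v0\<bar> ^ (2 * p - 3)"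
proof -
  let ?f1 = "\<lambda>x. fst (\<phi> x)" and ?f2 = "\<lambda>x. snd (\<phi> x)"
  \<comment> \<open>\<open>H\<close> combines the components after \<open>D\<close> has been applied
    to each, so linear identities such as Euler's are inherited from the components of
    \<phi>.\<close>
  define H where "H = (\<lambda>D :: (real \<times> real \<Rightarrow> real) \<Rightarrow> real. fst \<zeta> * D ?f1 + snd \<zeta> * D ?f2)"
  have hom1: "?f1 (dil \<alpha>1 \<alpha>2 t x) = t powr m * ?f1 x" "?f2 (dil \<alpha>1 \<alpha>2 t x) = t powr m * ?f2 x"
    if "x \<in> U" "0 < t" for x t using hom[OF that] by simp_all
  have euler: "\<alpha>1 * fst x * H (\<lambda>f. pd1 f x) + \<alpha>2 * snd x * H (\<lambda>f. pd2 f x) = m * H (\<lambda>f. f x)"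
    "\<alpha>1 * fst x * H (\<lambda>f. pd1 (pd1 f) x) + \<alpha>2 * snd x * H (\<lambda>f. pd1 (pd2 f) x) = (m - \<alpha>1) * H (\<lambda>f. pd1 f x)"
    "\<alpha>1 * fst x * H (\<lambda>f. pd1 (pd2 f) x) + \<alpha>2 * snd x * H (\<lambda>f. pd2 (pd2 f) x) = (m - \<alpha>2) * H (\<lambda>f. pd2 f x)"
    if xU: "x \<in> U" for x
  proof -
    have comb: "c1 * H D1 + c2 * H D2 = c3 * H D3"
      if "c1 * D1 ?f1 + c2 * D2 ?f1 = c3 * D3 ?f1" "c1 * D1 ?f2 + c2 * D2 ?f2 = c3 * D3 ?f2"
      for c1 c2 c3 :: real and D1 D2 D3
    proof -
      have "c1 * H D1 + c2 * H D2 = fst \<zeta> * (c1 * D1 ?f1 + c2 * D2 ?f1) + snd \<zeta> * (c1 * D1 ?f2 + c2 * D2 ?f2)"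
        by (simp add: H_def algebra_simps)
      also have "\<dots> = c3 * H D3" unfolding that by (simp add: H_def algebra_simps)
      finally show ?thesis .
    qed
    show "\<alpha>1 * fst x * H (\<lambda>f. pd1 f x) + \<alpha>2 * snd x * H (\<lambda>f. pd2 f x) = m * H (\<lambda>f. f x)"
      by (rule comb; rule euler_identity) (use an xU hom1 in auto)
    show "\<alpha>1 * fst x * H (\<lambda>f. pd1 (pd1 f) x) + \<alpha>2 * snd x * H (\<lambda>f. pd1 (pd2 f) x) = (m - \<alpha>1) * H (\<lambda>f. pd1 f x)"
      by (rule comb; rule euler_identity_deriv(1)[OF _ U xU]) (use an hom1 in auto)
    show "\<alpha>1 * fst x * H (\<lambda>f. pd1 (pd2 f) x) + \<alpha>2 * snd x * H (\<lambda>f. pd2 (pd2 f) x) = (m - \<alpha>2) * H (\<lambda>f. pd2 f x)"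
      by (rule comb; rule euler_identity_deriv(2)[OF _ U xU]) (use an hom1 in auto)
  qed
  have Q: "Qform \<phi> x \<zeta> = H (\<lambda>f. pd1 (pd1 f) x) * H (\<lambda>f. pd2 (pd2 f) x) - H (\<lambda>f. pd1 (pd2 f) x) * H (\<lambda>f. pd1 (pd2 f) x)"
    if "x \<in> U" for x
    using Qform_eq[OF an that] by (simp add: H_def Let_def)
  let ?x = "(u, v0)"
  have second: "\<epsilon>\<^sup>2 * H (\<lambda>f. pd1 (pd1 f) ?x) + 2 * \<epsilon> * H (\<lambda>f. pd1 (pd2 f) ?x) + H (\<lambda>f. pd2 (pd2 f) ?x) = 0"
    if "\<epsilon> \<in> {0, e, 2 * e}" for \<epsilon>
  proof -
    have "fst \<zeta> * Dd \<epsilon> (Dd \<epsilon> ?f1) ?x + snd \<zeta> * Dd \<epsilon> (Dd \<epsilon> ?f2) ?x = 0"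
      using z[OF that, of 2] p by (simp add: numeral_2_eq_2)
    then show ?thesis
      by (simp add: Dd_Dd[OF an(1) x(1)] Dd_Dd[OF an(2) x(1)] H_def algebra_simps)
  qed
  have h22: "H (\<lambda>f. pd2 (pd2 f) ?x) = 0" using second[of 0] by simp
  have h: "H (\<lambda>f. pd1 (pd1 f) ?x) = 0" "H (\<lambda>f. pd1 (pd2 f) ?x) = 0"
    using quadratic_zero_three[OF e h22, of "H (\<lambda>f. pd1 (pd1 f) ?x)" "H (\<lambda>f. pd1 (pd2 f) ?x)"]
      second[of e] second[of "2 * e"] by auto
  show "Qform \<phi> ?x \<zeta> = 0" by (simp add: Q[OF x(1)] h)
  \<comment> \<open>Read backwards, Euler's relations lead from vanishing second derivatives to
    vanishing first derivatives and then to the value itself, since m - \<alpha>1, m - \<alpha>2 and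
    m are nonzero.\<close>
  have m12: "m \<noteq> \<alpha>1" "m \<noteq> \<alpha>2" "m \<noteq> 0" using m \<alpha> by auto
  have P2: "H (\<lambda>f. pd2 f ?x) = 0" using euler(3)[OF x(1)] h h22 m12 by simp
  have P1: "H (\<lambda>f. pd1 f ?x) = 0" using euler(2)[OF x(1)] h h22 m12 by simp
  have P0: "H (\<lambda>f. f ?x) = 0" using euler(1)[OF x(1)] P1 P2 m12 by simp
  define F where "F = (\<lambda>k v. H (\<lambda>f. (pd2 ^^ k) f (u, v)))"
  have F0: "F k v0 = 0" if "k < p" for k
  proof -
    have "k = 0 \<or> k = 1 \<or> 2 \<le> k" by arith
    then consider "k = 0" | "k = 1" | "k \<in> {2..<p}" using \<open>k < p\<close> by (auto simp del: One_nat_def)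
    then show ?thesis
    proof cases
      case 3
      then show ?thesis using z[of 0 k] by (simp add: F_def H_def Dd_0)
    qed (use P0 P2 in \<open>simp_all add: F_def\<close>)
  qed
  have "open ((\<lambda>v. (u, v)) -` U)" by (intro open_vimage U continuous_intros)
  then obtain s0 where s0: "s0 > 0" "\<And>v. \<bar>v - v0\<bar> < s0 \<Longrightarrow> (u, v) \<in> U"
    using x(1) unfolding open_dist by (auto simp: dist_real_def)
  \<comment> \<open>s \<le> 1 allows higher powers of |v - v0| to be replaced by the power 2p - 3,
    and bounds |v| by |v0| + 1.\<close>
  define s where "s = min (s0 / 2) 1"
  have s: "0 < s" "s \<le> 1" "\<And>v. \<bar>v - v0\<bar> \<le> s \<Longrightarrow> (u, v) \<in> U" using s0 by (auto simp: s_def)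
  have anp: "real_analytic2_on ((pd2 ^^ k) f) U" if "real_analytic2_on f U" for f k
    using real_analytic2_on_Dd_pow[OF that, where \<epsilon> = 0 and k = k] by (simp add: Dd_0)
  have dF: "(F k has_real_derivative F (Suc k) v) (at v)" if "\<bar>v - v0\<bar> \<le> s" for k v
    unfolding F_def H_def funpow.simps o_def
    by (intro DERIV_add DERIV_cmult real_analytic2_DERIV_pd2[OF anp s(3)[OF that]] an)
  have "continuous_on {v0 - s..v0 + s} (F p)"
    by (intro continuous_at_imp_continuous_on ballI DERIV_isCont[OF dF]) auto
  then have "compact (F p ` {v0 - s..v0 + s})" by (intro compact_continuous_image) auto
  then obtain M where M: "\<And>v. v \<in> {v0 - s..v0 + s} \<Longrightarrow> \<bar>F p v\<bar> \<le> M"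
    using compact_imp_bounded bounded_iff by (metis imageI real_norm_def)
  have Fb: "\<bar>F k v\<bar> \<le> M * \<bar>v - v0\<bar> ^ (p - k)" if "k \<le> p" "\<bar>v - v0\<bar> \<le> s" for k v
    by (rule flat_bound[where p = p and s = s]) (use dF F0 M that in \<open>auto simp: abs_le_iff\<close>)
  have M0: "0 \<le> M" using M[of v0] s by (smt (verit) abs_ge_zero atLeastAtMost_iff)
  define C where "C = \<bar>m * (m - \<alpha>1)\<bar> * (M * M) + \<bar>\<alpha>2 * (\<alpha>1 - \<alpha>2)\<bar> * (\<bar>v0\<bar> + 1) * (M * M) + (m - \<alpha>2)\<^sup>2 * (M * M)"
  have "\<bar>Qform \<phi> (u, v) \<zeta>\<bar> \<le> C / (\<alpha>1 * u)\<^sup>2 * \<bar>v - v0\<bar> ^ (2 * p - 3)" if v: "\<bar>v - v0\<bar> \<le> s" for v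
  proof -
    define r where "r = \<bar>v - v0\<bar>"
    have r: "0 \<le> r" "r \<le> 1" using v s by (auto simp: r_def)
    have id: "(\<alpha>1 * u)\<^sup>2 * Qform \<phi> (u, v) \<zeta> =
        m * (m - \<alpha>1) * F 0 v * F 2 v + \<alpha>2 * (\<alpha>1 - \<alpha>2) * v * F 1 v * F 2 v - (m - \<alpha>2)\<^sup>2 * (F 1 v)\<^sup>2"
      using hessian_det_identity[OF euler[OF s(3)[OF v], unfolded fst_conv snd_conv]]
      by (simp add: Q[OF s(3)[OF v]] F_def numeral_2_eq_2)
    \<comment> \<open>The identity contains the pairs (0, 2), (1, 2) and (1, 1); the pair (1, 2) is
      the one that limits the order to 2p - 3.\<close>
    have prod: "\<bar>F i v * F j v\<bar> \<le> M * M * r ^ (2 * p - 3)" if "i + j \<le> 3" "i \<le> p" "j \<le> p" for i j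
    proof -
      have "\<bar>F i v * F j v\<bar> \<le> (M * r ^ (p - i)) * (M * r ^ (p - j))"
        unfolding abs_mult r_def using Fb that v M0 by (intro mult_mono) auto
      also have "\<dots> = M * M * r ^ (2 * p - i - j)"
      proof -
        have "2 * p - i - j = (p - i) + (p - j)" using that by simp
        then show ?thesis by (simp add: power_add)
      qed
      also have "\<dots> \<le> M * M * r ^ (2 * p - 3)"
        using r M0 that by (intro mult_left_mono power_decreasing) auto
      finally show ?thesis .
    qed
    define W where "W = M * M * r ^ (2 * p - 3)"
    have "\<bar>m * (m - \<alpha>1) * (F 0 v * F 2 v)\<bar> \<le> \<bar>m * (m - \<alpha>1)\<bar> * W"
      unfolding W_def abs_mult[of "m * (m - \<alpha>1)"] using prod[of 0 2] p by (intro mult_left_mono) auto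
    moreover have "\<bar>(\<alpha>2 * (\<alpha>1 - \<alpha>2) * v) * (F 1 v * F 2 v)\<bar> \<le> (\<bar>\<alpha>2 * (\<alpha>1 - \<alpha>2)\<bar> * (\<bar>v0\<bar> + 1)) * W"
      unfolding abs_mult[of "\<alpha>2 * (\<alpha>1 - \<alpha>2) * v"] W_def
    proof (intro mult_mono prod)
      have "\<bar>v\<bar> \<le> \<bar>v0\<bar> + 1" using v s by linarith
      then show "\<bar>\<alpha>2 * (\<alpha>1 - \<alpha>2) * v\<bar> \<le> \<bar>\<alpha>2 * (\<alpha>1 - \<alpha>2)\<bar> * (\<bar>v0\<bar> + 1)"
        unfolding abs_mult[of "\<alpha>2 * (\<alpha>1 - \<alpha>2)" v] by (intro mult_left_mono) auto
    qed (use p in auto)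
    moreover have "\<bar>(m - \<alpha>2)\<^sup>2 * (F 1 v * F 1 v)\<bar> \<le> (m - \<alpha>2)\<^sup>2 * W"
      unfolding abs_mult[of "(m - \<alpha>2)\<^sup>2"] W_def using prod[of 1 1] p by (intro mult_mono) auto
    ultimately have "\<bar>m * (m - \<alpha>1) * (F 0 v * F 2 v) + (\<alpha>2 * (\<alpha>1 - \<alpha>2) * v) * (F 1 v * F 2 v) - (m - \<alpha>2)\<^sup>2 * (F 1 v * F 1 v)\<bar>
        \<le> \<bar>m * (m - \<alpha>1)\<bar> * W + (\<bar>\<alpha>2 * (\<alpha>1 - \<alpha>2)\<bar> * (\<bar>v0\<bar> + 1)) * W + (m - \<alpha>2)\<^sup>2 * W"
      by linarith
    also have "\<dots> = C * r ^ (2 * p - 3)" by (simp add: C_def W_def algebra_simps)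
    finally have "\<bar>(\<alpha>1 * u)\<^sup>2 * Qform \<phi> (u, v) \<zeta>\<bar> \<le> C * r ^ (2 * p - 3)"
      unfolding id by (simp add: power2_eq_square mult.assoc)
    then have "(\<alpha>1 * u)\<^sup>2 * \<bar>Qform \<phi> (u, v) \<zeta>\<bar> \<le> C * r ^ (2 * p - 3)" by (simp add: abs_mult)
    moreover have "0 < (\<alpha>1 * u)\<^sup>2" using x \<alpha> by simp
    ultimately show ?thesis by (simp add: r_def field_simps)
  qed
  then show "\<exists>s>0. \<exists>B. \<forall>v. \<bar>v - v0\<bar> \<le> s \<longrightarrow> \<bar>Qform \<phi> (u, v) \<zeta>\<bar> \<le> B * \<bar>v - v0\<bar> ^ (2 * p - 3)"
    using s(1) by blast
qed

section \<open>The sector integral\<close>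

lemma powr_lipschitz_on_Icc:
  fixes lo \<kappa> :: real
  assumes "0 < lo"
  obtains L where "0 \<le> L" "\<And>w w'. w \<in> {lo..1} \<Longrightarrow> w' \<in> {lo..1} \<Longrightarrow> \<bar>w powr \<kappa> - w' powr \<kappa>\<bar> \<le> L * \<bar>w - w'\<bar>"
proof -
  have "continuous_on {lo..1} (\<lambda>w. \<kappa> * w powr (\<kappa> - 1))"
    using assms by (intro continuous_intros) auto
  then have "bounded ((\<lambda>w. \<kappa> * w powr (\<kappa> - 1)) ` {lo..1})"
    by (intro compact_imp_bounded compact_continuous_image) auto
  then obtain L where L: "L > 0" "\<And>w. w \<in> {lo..1} \<Longrightarrow> norm (\<kappa> * w powr (\<kappa> - 1)) \<le> L"
    unfolding bounded_pos by blast
  show thesis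
  proof (rule that[of L])
    show "0 \<le> L" using L by simp
    fix w w' assume ww: "w \<in> {lo..1}" "w' \<in> {lo..1}"
    have "norm (w powr \<kappa> - w' powr \<kappa>) \<le> L * norm (w - w')"
    proof (rule field_differentiable_bound[where S = "{lo..1}" and f' = "\<lambda>w. \<kappa> * w powr (\<kappa> - 1)"])
      show "((\<lambda>w. w powr \<kappa>) has_field_derivative \<kappa> * z powr (\<kappa> - 1)) (at z within {lo..1})" if "z \<in> {lo..1}" for z
        using that assms by (intro has_real_derivative_powr[THEN has_field_derivative_at_within]) auto
    qed (use L ww in auto)
    then show "\<bar>w powr \<kappa> - w' powr \<kappa>\<bar> \<le> L * \<bar>w - w'\<bar>" by simp
  qed
qed

text \<open>Along the segment, the height of either boundary curve changes by at most the increment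
  of u. So being above the lower curve persists as u grows, and being below the upper curve persists
  as u decreases: each curve is crossed in one direction only.\<close>

lemma is_interval_sector_section:
  fixes c d lo \<kappa> L \<epsilon> y :: real
  assumes L: "\<And>w w'. w \<in> {lo..1} \<Longrightarrow> w' \<in> {lo..1} \<Longrightarrow> \<bar>w powr \<kappa> - w' powr \<kappa>\<bar> \<le> L * \<bar>w - w'\<bar>" "0 \<le> L"
    and \<epsilon>: "0 \<le> \<epsilon>" "\<epsilon> * (L * (\<bar>c\<bar> + \<bar>d\<bar>)) \<le> 1"
  shows "is_interval {u. lo \<le> y + \<epsilon> * u \<and> y + \<epsilon> * u < 1 \<and>
      c * (y + \<epsilon> * u) powr \<kappa> < u \<and> u < d * (y + \<epsilon> * u) powr \<kappa>}"
  unfolding is_interval_1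
proof (intro ballI allI impI)
  fix p q u
  let ?S = "{u. lo \<le> y + \<epsilon> * u \<and> y + \<epsilon> * u < 1 \<and>
      c * (y + \<epsilon> * u) powr \<kappa> < u \<and> u < d * (y + \<epsilon> * u) powr \<kappa>}"
  assume pq: "p \<in> ?S" "q \<in> ?S" and u: "p \<le> u \<and> u \<le> q"
  define w where "w = (\<lambda>u. y + \<epsilon> * u)"
  have w: "w p \<le> w u" "w u \<le> w q" using u \<epsilon> by (auto simp: w_def mult_left_mono)
  have I: "w p \<in> {lo..1}" "w q \<in> {lo..1}" "w u \<in> {lo..1}" "w u < 1" using pq w by (auto simp: w_def)
  have lip: "\<bar>e * w i powr \<kappa> - e * w j powr \<kappa>\<bar> \<le> j - i"
    if "\<bar>e\<bar> \<le> \<bar>c\<bar> + \<bar>d\<bar>" "i \<le> j" "w i \<in> {lo..1}" "w j \<in> {lo..1}" for e i j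
  proof -
    have "\<bar>e * w i powr \<kappa> - e * w j powr \<kappa>\<bar> = \<bar>e\<bar> * \<bar>w i powr \<kappa> - w j powr \<kappa>\<bar>"
      by (simp add: abs_mult right_diff_distrib[symmetric])
    also have "\<dots> \<le> (\<bar>c\<bar> + \<bar>d\<bar>) * (L * \<bar>w i - w j\<bar>)"
      using L that by (intro mult_mono) auto
    also have "\<bar>w i - w j\<bar> = \<epsilon> * (j - i)"
    proof -
      have "w i - w j = - (\<epsilon> * (j - i))" by (simp add: w_def algebra_simps)
      moreover have "0 \<le> \<epsilon> * (j - i)" using that \<epsilon> by simp
      ultimately show ?thesis by simp
    qed
    also have "(\<bar>c\<bar> + \<bar>d\<bar>) * (L * (\<epsilon> * (j - i))) = \<epsilon> * (L * (\<bar>c\<bar> + \<bar>d\<bar>)) * (j - i)" by (simp add: mult_ac)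
    also have "\<dots> \<le> 1 * (j - i)" using \<epsilon> that by (intro mult_right_mono) auto
    finally show ?thesis by simp
  qed
  have "c * w u powr \<kappa> < u"
    using lip[of c p u] I u pq by (auto simp: w_def)
  moreover have "u < d * w u powr \<kappa>"
    using lip[of d u q] I u pq by (auto simp: w_def)
  ultimately show "u \<in> ?S" using I by (auto simp: w_def)
qed

text \<open>The restriction lo \<le> x1 survives in the closure and keeps away from x1 = 0, where
  \<open>powr\<close> need not be continuous.\<close>

lemma closure_sector_subset:
  assumes \<alpha>1: "0 < \<alpha>1" and lo: "0 < lo" and \<kappa>: "\<kappa> = \<alpha>2 / \<alpha>1"
  shows "closure {x \<in> cone \<alpha>1 \<alpha>2 c d. lo \<le> fst x \<and> fst x < 1} \<subseteq>
    {x. lo \<le> fst x \<and> c * fst x powr \<kappa> \<le> snd x \<and> snd x \<le> d * fst x powr \<kappa>}"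
proof (rule closure_minimal)
  let ?H = "{x :: real \<times> real. lo \<le> fst x}"
  have H: "closed ?H" by (intro closed_Collect_le continuous_intros)
  have c: "continuous_on ?H (\<lambda>x. snd x - a * fst x powr \<kappa>)" for a
    using lo by (intro continuous_intros) auto
  have "{x. lo \<le> fst x \<and> c * fst x powr \<kappa> \<le> snd x \<and> snd x \<le> d * fst x powr \<kappa>} =
      (?H \<inter> (\<lambda>x. snd x - c * fst x powr \<kappa>) -` {0..}) \<inter> (?H \<inter> (\<lambda>x. snd x - d * fst x powr \<kappa>) -` {..0})"
    by auto
  also have "closed \<dots>"
    by (intro closed_Int continuous_closed_preimage c H) auto
  finally show "closed {x. lo \<le> fst x \<and> c * fst x powr \<kappa> \<le> snd x \<and> snd x \<le> d * fst x powr \<kappa>}" .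
qed (auto simp: cone_iff[OF \<alpha>1] \<kappa>)

text \<open>This serves (H3), which speaks of the closure of the whole sector: a boundary point is
  approached along its vertical line.\<close>

lemma closed_sector_subset_closure:
  assumes \<alpha>1: "0 < \<alpha>1" and cd: "c < d"
    and x: "0 < fst x" "c * fst x powr (\<alpha>2 / \<alpha>1) \<le> snd x" "snd x \<le> d * fst x powr (\<alpha>2 / \<alpha>1)"
  shows "x \<in> closure (cone \<alpha>1 \<alpha>2 c d)"
proof -
  define q where "q = fst x powr (\<alpha>2 / \<alpha>1)"
  have q: "q > 0" using x by (simp add: q_def)
  have "(\<lambda>s. (fst x, q * s)) ` closure {c<..<d} \<subseteq> closure (cone \<alpha>1 \<alpha>2 c d)"
  proof (rule image_closure_subset)
    show "continuous_on (closure {c<..<d}) (\<lambda>s. (fst x, q * s))" by (intro continuous_intros)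
    have "(fst x, q * s) \<in> cone \<alpha>1 \<alpha>2 c d" if "c < s" "s < d" for s
      using that x(1) q by (simp add: cone_iff[OF \<alpha>1] q_def[symmetric] mult.commute)
    then show "(\<lambda>s. (fst x, q * s)) ` {c<..<d} \<subseteq> closure (cone \<alpha>1 \<alpha>2 c d)"
      using closure_subset by fastforce
  qed simp
  moreover have "x = (\<lambda>s. (fst x, q * s)) (snd x / q)" using q by (simp add: prod_eq_iff)
  moreover have "snd x / q \<in> closure {c<..<d}" using x(2,3) q cd by (auto simp: q_def[symmetric] field_simps)
  ultimately show ?thesis by blast
qed

lemma lborel_integral_scale2:
  fixes g :: "real \<times> real \<Rightarrow> complex"
  assumes g: "g \<in> borel_measurable borel" and r: "0 < r1" "0 < r2"
  shows "integral\<^sup>L lborel g = (r1 * r2) *\<^sub>R integral\<^sup>L lborel (\<lambda>x. g (r1 * fst x, r2 * snd x))"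
proof -
  define c where "c = (\<lambda>j :: real \<times> real. if j = (1, 0) then r1 else r2)"
  define T where "T = (\<lambda>x :: real \<times> real. 0 + (\<Sum>j\<in>Basis. (c j * (x \<bullet> j)) *\<^sub>R j))"
  have B: "Basis = {(1, 0), (0, 1 :: real)} \<union> ({} :: (real \<times> real) set)" by (auto simp: Basis_prod_def)
  have T: "T = (\<lambda>x. (r1 * fst x, r2 * snd x))"
    unfolding T_def B by (auto simp: c_def inner_prod_def)
  have p: "(\<Prod>j\<in>Basis. \<bar>c j\<bar>) = r1 * r2" unfolding B using r by (simp add: c_def)
  have "lborel = density (distr lborel borel T) (\<lambda>_. ennreal (\<Prod>j\<in>Basis. \<bar>c j\<bar>))"
    unfolding T_def by (rule lborel_affine_euclidean) (use r in \<open>auto simp: c_def\<close>)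
  then have "integral\<^sup>L lborel g = integral\<^sup>L (density (distr lborel borel T) (\<lambda>_. ennreal (r1 * r2))) g"
    unfolding p by simp
  also have "\<dots> = integral\<^sup>L (distr lborel borel T) (\<lambda>x. (r1 * r2) *\<^sub>R g x)"
    using r g by (intro integral_density) auto
  also have "\<dots> = integral\<^sup>L lborel (\<lambda>x. (r1 * r2) *\<^sub>R g (T x))"
  proof (rule integral_distr)
    have "T \<in> borel_measurable borel"
      unfolding T by (rule borel_measurable_continuous_onI) (intro continuous_intros)
    then show "T \<in> lborel \<rightarrow>\<^sub>M borel" by simp
    show "(\<lambda>x. (r1 * r2) *\<^sub>R g x) \<in> borel_measurable borel" using g by simp
  qed
  finally show ?thesis by (simp add: T)
qed

theorem theorem3p8:
  fixes \<alpha>1 \<alpha>2 a b c d \<sigma> m D \<delta> :: real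
    and n1 n2 :: nat
    and \<phi> :: "real \<times> real \<Rightarrow> real \<times> real"
  assumes alpha: "0 < \<alpha>1" "0 < \<alpha>2" "\<alpha>1 \<noteq> \<alpha>2"
    and H1: "real_analytic2_on (\<lambda>x. fst (\<phi> x)) (cone \<alpha>1 \<alpha>2 a b)"
            "real_analytic2_on (\<lambda>x. snd (\<phi> x)) (cone \<alpha>1 \<alpha>2 a b)"
    and H2: "m \<ge> 3 * (\<alpha>1 + \<alpha>2)"
            "\<forall>x\<in>cone \<alpha>1 \<alpha>2 a b. \<forall>t>0. \<phi> (dil \<alpha>1 \<alpha>2 t x) = (t powr m) *\<^sub>R \<phi> x"
    and H3: "a < c" "c < d" "d < b" "c \<le> \<sigma>" "\<sigma> \<le> d"
            "{x \<in> closure (cone \<alpha>1 \<alpha>2 c d) - {0}. \<not> elliptic \<phi> x}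
               = {dil \<alpha>1 \<alpha>2 t (1, \<sigma>) | t. 0 < t}"
    and H4: "0 < n1" "0 < n2" "0 < D" "0 < \<delta>"
            "c < \<sigma> \<Longrightarrow> \<forall>s. \<sigma> - \<delta> < s \<and> s < \<sigma> \<longrightarrow> (\<forall>t>0.
                 (INF \<zeta>\<in>sphere 0 1. \<bar>Qform \<phi> (dil \<alpha>1 \<alpha>2 t (1, s)) \<zeta>\<bar>)
                   \<ge> D * t powr (2 * (m - \<alpha>1 - \<alpha>2)) * \<bar>s - \<sigma>\<bar> ^ n1)"
            "\<sigma> < d \<Longrightarrow> \<forall>s. \<sigma> < s \<and> s < \<sigma> + \<delta> \<longrightarrow> (\<forall>t>0.
                 (INF \<zeta>\<in>sphere 0 1. \<bar>Qform \<phi> (dil \<alpha>1 \<alpha>2 t (1, s)) \<zeta>\<bar>)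
                   \<ge> D * t powr (2 * (m - \<alpha>1 - \<alpha>2)) * \<bar>s - \<sigma>\<bar> ^ n2)"
            "real (max n1 n2) < 2 * m / (\<alpha>1 + \<alpha>2) - 3"
  shows "\<exists>C>0. \<forall>\<xi>1 \<xi>2. \<xi>2 \<noteq> 0 \<longrightarrow>
           norm (mu_hat \<alpha>1 \<alpha>2 c d \<phi> \<xi>1 \<xi>2) \<le> C * norm \<xi>2 powr (- (\<alpha>1 + \<alpha>2) / m)"
proof -

  \<comment> \<open>Parameters and the dyadic piece\<close>
  define U where "U = cone \<alpha>1 \<alpha>2 a b"
  define V where "V = cone \<alpha>1 \<alpha>2 c d"
  define \<kappa> where "\<kappa> = \<alpha>2 / \<alpha>1"
  define \<alpha> where "\<alpha> = \<alpha>1 + \<alpha>2"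
  define p where "p = nat \<lceil>m / \<alpha>\<rceil>"
  have \<alpha>: "0 < \<alpha>" using alpha by (simp add: \<alpha>_def)
  have m: "0 < m" "\<alpha> < m" using H2(1) \<alpha> by (auto simp: \<alpha>_def)
  have m3: "3 \<le> m / \<alpha>" using H2(1) \<alpha> by (simp add: \<alpha>_def[symmetric] field_simps)
  have p_ge: "m / \<alpha> \<le> real p" "real p < m / \<alpha> + 1" using m3 unfolding p_def by linarith+
  have p3: "3 \<le> p" using p_ge m3 by linarith
  have n_p: "n < 2 * p - 3" if "n \<le> max n1 n2" for n
  proof -
    have "real n \<le> real (max n1 n2)" using that by simp
    also have "\<dots> < 2 * (m / \<alpha>) - 3" using H4(7) by (simp add: \<alpha>_def)
    also have "\<dots> \<le> 2 * real p - 3" using p_ge by simp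
    finally show ?thesis using p3 by linarith
  qed
  note an = H1[folded U_def]
  have U: "open U" unfolding U_def by (rule open_cone[OF alpha(1)])
  have hom: "\<phi> (dil \<alpha>1 \<alpha>2 t x) = t powr m *\<^sub>R \<phi> x" if "x \<in> U" "0 < t" for x t
    using H2(2) that by (simp add: U_def)
  have closedU: "x \<in> U" if "0 < fst x" "c * fst x powr \<kappa> \<le> snd x" "snd x \<le> d * fst x powr \<kappa>" for x
  proof -
    have "a * fst x powr \<kappa> < c * fst x powr \<kappa>" "d * fst x powr \<kappa> < b * fst x powr \<kappa>"
      using H3 that(1) by auto
    then show ?thesis
      unfolding U_def cone_iff[OF alpha(1)] \<kappa>_def[symmetric] using that by (intro conjI; linarith)
  qed
  have VU: "V \<subseteq> U" using closedU by (auto simp: V_def cone_iff[OF alpha(1)] \<kappa>_def[symmetric])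
  \<comment> \<open>The dilation by 1/2 multiplies x1 by \<open>lo\<close>, so \<open>A\<close> is
    the part of the sector with 1/2 \<le> t < 1.\<close>
  define lo where "lo = 2 powr (- \<alpha>1)"
  have lo: "0 < lo" "lo < 1" using alpha by (auto simp: lo_def powr_less_one)
  define A where "A = {x \<in> V. lo \<le> fst x \<and> fst x < 1}"
  obtain L where L: "0 \<le> L" "\<And>w w'. w \<in> {lo..1} \<Longrightarrow> w' \<in> {lo..1} \<Longrightarrow> \<bar>w powr \<kappa> - w' powr \<kappa>\<bar> \<le> L * \<bar>w - w'\<bar>"
    using powr_lipschitz_on_Icc[OF lo(1)] by blast
  \<comment> \<open>\<open>Q\<close> bounds the slopes of both boundary curves over lo \<le> x1
    \<le> 1. The choice of e makes 2e Q \<le> 1, so that even the direction (2e, 1) is steep enough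
    for interval sections, and 2e \<le> 1 as the slicing estimate asks.\<close>
  define Q where "Q = L * (\<bar>c\<bar> + \<bar>d\<bar>)"
  have Q: "0 \<le> Q" using L by (simp add: Q_def)
  define e where "e = 1 / (2 * (1 + Q))"
  have e: "0 < e" "2 * e \<le> 1" "2 * e * Q \<le> 1" using Q by (auto simp: e_def field_simps)
  define E where "E = {0, e, 2 * e}"
  have E: "0 \<le> \<epsilon> \<and> \<epsilon> \<le> 1 \<and> \<epsilon> * Q \<le> 1" if "\<epsilon> \<in> E" for \<epsilon>
  proof -
    have "e * Q \<le> 2 * e * Q" using e Q by simp
    then show ?thesis using that e by (auto simp: E_def)
  qed
  define R where "R = 1 + \<bar>c\<bar> + \<bar>d\<bar>"
  have R: "0 < R" by (simp add: R_def)
  have inV: "x \<in> V \<longleftrightarrow> 0 < fst x \<and> c * fst x powr \<kappa> < snd x \<and> snd x < d * fst x powr \<kappa>" for x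
    by (simp add: V_def cone_iff[OF alpha(1)] \<kappa>_def)
  have box: "{x \<in> V. fst x < 1} \<subseteq> {-R..R} \<times> {-R..R}"
  proof
    fix x assume "x \<in> {x \<in> V. fst x < 1}"
    then have x: "0 < fst x" "fst x < 1" "c * fst x powr \<kappa> < snd x" "snd x < d * fst x powr \<kappa>" by (auto simp: inV)
    define w where "w = fst x powr \<kappa>"
    have w: "0 \<le> w" "w \<le> 1" using x alpha by (auto simp: w_def \<kappa>_def intro!: powr_le1)
    have "\<bar>c * w\<bar> \<le> \<bar>c\<bar> * 1" "\<bar>d * w\<bar> \<le> \<bar>d\<bar> * 1" unfolding abs_mult using w by (intro mult_left_mono; simp)+
    then have "\<bar>snd x\<bar> \<le> R" using x(3,4) unfolding w_def[symmetric] R_def by linarith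
    then show "x \<in> {-R..R} \<times> {-R..R}" using x by (auto simp: mem_Times_iff R_def)
  qed
  have Vb: "V \<in> sets borel" unfolding V_def using open_cone[OF alpha(1)] by simp
  have half: "{x :: real \<times> real. fst x < r} \<in> sets borel" "{x :: real \<times> real. r \<le> fst x} \<in> sets borel" for r
    by (intro borel_open open_Collect_less continuous_intros) (intro borel_closed closed_Collect_le continuous_intros)
  have Vr: "{x \<in> V. fst x < r} \<in> sets borel" for r
    using sets.Int[OF Vb half(1)[of r]] by (simp add: Int_def)
  have "A = {x \<in> V. fst x < 1} \<inter> {x. lo \<le> fst x}" by (auto simp: A_def)
  then have Ab: "A \<in> sets borel" using sets.Int[OF Vr half(2)] by simp
  have clA: "0 < fst x" "c * fst x powr \<kappa> \<le> snd x" "snd x \<le> d * fst x powr \<kappa>" if "x \<in> closure A" for x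
    using subsetD[OF closure_sector_subset[OF alpha(1) lo(1) \<kappa>_def] that[unfolded A_def V_def]] lo by auto
  have AU: "closure A \<subseteq> U" using closedU clA by blast
  have nondeg: "\<exists>\<epsilon>\<in>E. \<exists>k\<in>{2..<p}. fst \<zeta> * (Dd \<epsilon> ^^ k) (\<lambda>x. fst (\<phi> x)) x + snd \<zeta> * (Dd \<epsilon> ^^ k) (\<lambda>x. snd (\<phi> x)) x \<noteq> 0"
    if x: "x \<in> closure A" and \<zeta>: "\<zeta> \<in> sphere 0 1" for x \<zeta>
  proof (rule ccontr)
    assume neg: "\<not> ?thesis"
    obtain u v0 where uv: "x = (u, v0)" by (cases x)
    have u: "0 < u" using clA[OF x] uv by simp
    have xU: "(u, v0) \<in> U" using AU x uv by auto
    have m': "\<alpha>1 + \<alpha>2 < m" using m by (simp add: \<alpha>_def)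
    have z: "fst \<zeta> * (Dd \<epsilon> ^^ k) (\<lambda>x. fst (\<phi> x)) (u, v0) + snd \<zeta> * (Dd \<epsilon> ^^ k) (\<lambda>x. snd (\<phi> x)) (u, v0) = 0"
      if "\<epsilon> \<in> {0, e, 2 * e}" "k \<in> {2..<p}" for \<epsilon> k
      using neg that unfolding E_def uv by blast
    note flat = Qform_flat_bound[OF an U xU u alpha(1,2) m' p3 e(1) hom z]
    \<comment> \<open>A zero of the form at one unit vector makes the minimum zero. So x lies on the
      degenerate curve, where the lower bound of (H4) can be confronted with flatness.\<close>
    have "(INF \<zeta>\<in>sphere 0 1. \<bar>Qform \<phi> x \<zeta>\<bar>) \<le> 0"
      using INF_Qform_le[OF \<zeta>, of \<phi> x] flat(1) by (simp add: uv)
    then have "\<not> elliptic \<phi> x" by (simp add: elliptic_def)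
    moreover have "x \<in> closure (cone \<alpha>1 \<alpha>2 c d)"
      using closed_sector_subset_closure[OF alpha(1) H3(2)] clA[OF x] unfolding \<kappa>_def by blast
    moreover have "x \<noteq> 0" using u uv by (auto simp: prod_eq_iff)
    ultimately have "x \<in> {dil \<alpha>1 \<alpha>2 t (1, \<sigma>) | t. 0 < t}" using H3(6) by blast
    then obtain t where t: "0 < t" and xt: "x = dil \<alpha>1 \<alpha>2 t (1, \<sigma>)" by blast
    have ut: "u = t powr \<alpha>1" "v0 = t powr \<alpha>2 * \<sigma>" using xt uv by (auto simp: dil_def)
    \<comment> \<open>At fixed t the points \<open>dil \<alpha>1 \<alpha>2 t (1, s)\<close> run
      along the vertical line through x, with s - \<sigma> scaled by \<open>T\<close>; both bounds
      can therefore be compared on one line.\<close>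
    define T where "T = t powr \<alpha>2"
    have T: "0 < T" using t by (simp add: T_def)
    obtain s0 B where s0: "0 < s0" and B: "\<And>v. \<bar>v - v0\<bar> \<le> s0 \<Longrightarrow> \<bar>Qform \<phi> (u, v) \<zeta>\<bar> \<le> B * \<bar>v - v0\<bar> ^ (2 * p - 3)"
      using flat(2) by blast
    define G where "G = D * t powr (2 * (m - \<alpha>1 - \<alpha>2))"
    have G: "0 < G" using H4 t by (simp add: G_def)
    have upper: "(INF \<zeta>\<in>sphere 0 1. \<bar>Qform \<phi> (dil \<alpha>1 \<alpha>2 t (1, s)) \<zeta>\<bar>) \<le> B * T ^ (2 * p - 3) * \<bar>s - \<sigma>\<bar> ^ (2 * p - 3)"
      if "\<bar>s - \<sigma>\<bar> < s0 / T" for s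
    proof -
      have eq: "T * s - v0 = T * (s - \<sigma>)" by (simp add: ut T_def algebra_simps)
      have "\<bar>T * s - v0\<bar> \<le> s0" unfolding eq abs_mult using that T by (simp add: field_simps)
      from B[OF this] have "\<bar>Qform \<phi> (u, T * s) \<zeta>\<bar> \<le> B * T ^ (2 * p - 3) * \<bar>s - \<sigma>\<bar> ^ (2 * p - 3)"
        unfolding eq abs_mult using T by (simp add: power_mult_distrib mult_ac)
      moreover have "dil \<alpha>1 \<alpha>2 t (1, s) = (u, T * s)" by (simp add: dil_def ut T_def)
      ultimately show ?thesis using INF_Qform_le[OF \<zeta>, of \<phi> "(u, T * s)"] by simp
    qed
    define r where "r = min \<delta> (s0 / T)"
    have r: "0 < r" using H4 s0 T by (simp add: r_def)
    \<comment> \<open>As c < d, the curve can be approached inside the sector from at least one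
      side, and one side suffices.\<close>
    consider "c < \<sigma>" | "\<sigma> < d" using H3 by linarith
    then show False
    proof cases
      case 1
      have "G * h ^ n1 \<le> B * T ^ (2 * p - 3) * h ^ (2 * p - 3)" if h: "0 < h" "h < r" for h
        using H4(5)[OF 1, rule_format, of "\<sigma> - h" t] upper[of "\<sigma> - h"] h t by (simp add: G_def r_def)
      from power_gap_contradiction[OF G r n_p this] show False by simp
    next
      case 2
      have "G * h ^ n2 \<le> B * T ^ (2 * p - 3) * h ^ (2 * p - 3)" if h: "0 < h" "h < r" for h
        using H4(6)[OF 2, rule_format, of "\<sigma> + h" t] upper[of "\<sigma> + h"] h t by (simp add: G_def r_def)
      from power_gap_contradiction[OF G r n_p this] show False by simp
    qed
  qed
  have sect: "is_interval {u. (y + \<epsilon> * u, u) \<in> A}" if "\<epsilon> \<in> E" for \<epsilon> y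
  proof -
    have "{u. (y + \<epsilon> * u, u) \<in> A} = {u. lo \<le> y + \<epsilon> * u \<and> y + \<epsilon> * u < 1 \<and>
      c * (y + \<epsilon> * u) powr \<kappa> < u \<and> u < d * (y + \<epsilon> * u) powr \<kappa>}"
      using lo by (auto simp: A_def inV)
    then show ?thesis
      using is_interval_sector_section[OF L(2,1)] E[OF that] by (simp add: Q_def)
  qed
  have finE: "finite E" by (simp add: E_def)
  have E1: "0 \<le> \<epsilon> \<and> \<epsilon> \<le> 1" if "\<epsilon> \<in> E" for \<epsilon> using E[OF that] by blast
  have Abox: "A \<subseteq> {-R..R} \<times> {-R..R}" using box by (auto simp: A_def)
  obtain C where C: "0 < C" "\<And>\<xi>1 \<xi>2. \<xi>2 \<noteq> 0 \<Longrightarrow>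
      norm (LINT x:A|lborel. osc \<phi> \<xi>1 \<xi>2 x) \<le> C * norm \<xi>2 powr (- 1 / real (p - 1))"
    using osc_decay[OF an Ab AU Abox finE E1 R p3 sect nondeg] by blast

  \<comment> \<open>The dyadic recursion\<close>
  have V1: "cone1 \<alpha>1 \<alpha>2 c d = {x \<in> V. fst x < 1}" by (auto simp: cone1_iff[OF alpha(1)] V_def)
  have mu: "mu_hat \<alpha>1 \<alpha>2 c d \<phi> \<xi>1 \<xi>2 = (LINT x:{x \<in> V. fst x < 1}|lborel. osc \<phi> \<xi>1 \<xi>2 x)" for \<xi>1 \<xi>2
    by (simp add: mu_hat_def osc_def V1)
  have c\<phi>: "continuous_on U \<phi>"
    using continuous_on_Pair[OF an[THEN real_analytic2_imp_continuous_on]] by simp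
  have c\<phi>V: "continuous_on S \<phi>" if "S \<subseteq> V" for S using continuous_on_subset[OF c\<phi>] that VU by blast
  define h1 where "h1 = 2 powr (- \<alpha>1)"
  define h2 where "h2 = 2 powr (- \<alpha>2)"
  \<comment> \<open>The dilation by 1/2 is diagonal and hence its own adjoint, so the same map acts
    on \<xi>1. Homogeneity of \<phi> turns \<xi>2 into \<open>2 powr (- m) *\<^sub>R \<xi>2\<close>,
    and the Jacobian is \<open>2 powr (- \<alpha>)\<close>.\<close>
  define S where "S = (\<lambda>\<xi> :: real \<times> real. (h1 * fst \<xi>, h2 * snd \<xi>))"
  have h: "0 < h1" "0 < h2" by (auto simp: h1_def h2_def)
  have half_powr: "(1 / 2) powr q = 2 powr (- q)" for q :: real
    by (simp add: powr_divide powr_minus inverse_eq_divide)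
  have Sd: "S x = dil \<alpha>1 \<alpha>2 (1 / 2) x" for x
    by (simp only: S_def dil_def h1_def h2_def half_powr)
  have inner: "(LINT x:{x \<in> V. fst x < lo}|lborel. osc \<phi> \<xi>1 \<xi>2 x)
      = (h1 * h2) *\<^sub>R mu_hat \<alpha>1 \<alpha>2 c d \<phi> (S \<xi>1) (2 powr (- m) *\<^sub>R \<xi>2)" for \<xi>1 \<xi>2
  proof -
    define g where "g = (\<lambda>x. indicator {x \<in> V. fst x < lo} x *\<^sub>R osc \<phi> \<xi>1 \<xi>2 x)"
    have g: "g \<in> borel_measurable borel"
      unfolding g_def by (intro borel_measurable_continuous_on_indicator Vr continuous_on_osc c\<phi>V) auto
    have gS: "g (h1 * fst x, h2 * snd x) = indicator {x \<in> V. fst x < 1} x *\<^sub>R osc \<phi> (S \<xi>1) (2 powr (- m) *\<^sub>R \<xi>2) x" for x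
    proof -
      have "h1 powr \<kappa> = h2" using alpha by (simp add: h1_def h2_def powr_powr \<kappa>_def)
      then have SV: "S x \<in> V \<longleftrightarrow> x \<in> V"
        using h by (simp add: inV S_def powr_mult zero_less_mult_iff mult.left_commute[of _ h2])
      have lo1: "fst (S x) < lo \<longleftrightarrow> fst x < 1" using h by (simp add: S_def lo_def h1_def)
      have "osc \<phi> \<xi>1 \<xi>2 (S x) = osc \<phi> (S \<xi>1) (2 powr (- m) *\<^sub>R \<xi>2) x" if "x \<in> V"
      proof -
        have "\<phi> (S x) = (1 / 2) powr m *\<^sub>R \<phi> x" using hom[of x "1/2"] that VU by (auto simp: Sd)
        also have "(1 / 2) powr m = 2 powr (- m)" by (rule half_powr)
        finally have "\<phi> (S x) = 2 powr (- m) *\<^sub>R \<phi> x" .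
        then show ?thesis by (simp add: osc_def S_def inner_prod_def mult_ac)
      qed
      then show ?thesis using SV lo1 unfolding g_def S_def[symmetric]
        by (auto simp: indicator_def S_def)
    qed
    show ?thesis
      using lborel_integral_scale2[OF g h] unfolding gS by (simp add: set_lebesgue_integral_def mu g_def)
  qed
  have split: "mu_hat \<alpha>1 \<alpha>2 c d \<phi> \<xi>1 \<xi>2 = (LINT x:A|lborel. osc \<phi> \<xi>1 \<xi>2 x)
      + (LINT x:{x \<in> V. fst x < lo}|lborel. osc \<phi> \<xi>1 \<xi>2 x)" for \<xi>1 \<xi>2
  proof -
    have "{x \<in> V. fst x < 1} = A \<union> {x \<in> V. fst x < lo}" using lo by (auto simp: A_def)
    moreover have "A \<inter> {x \<in> V. fst x < lo} = {}" by (auto simp: A_def)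
    moreover have "{x \<in> V. fst x < lo} \<subseteq> {-R..R} \<times> {-R..R}" using box lo by auto
    ultimately show ?thesis unfolding mu
      using set_integral_Un[of A "{x \<in> V. fst x < lo}" lborel "osc \<phi> \<xi>1 \<xi>2"]
        set_integrable_osc[OF c\<phi>V Ab Abox, of \<xi>1 \<xi>2] set_integrable_osc[OF c\<phi>V Vr, of lo R \<xi>1 \<xi>2]
      by (auto simp: A_def)
  qed
  have "\<alpha> / m < 1 / real (p - 1)"
  proof -
    have "real (p - 1) < m / \<alpha>" "0 < real (p - 1)" using p_ge p3 by auto
    then show ?thesis using \<alpha> m by (simp add: field_simps)
  qed
  then have "\<exists>B>0. \<forall>\<xi>1 \<xi>2. \<xi>2 \<noteq> 0 \<longrightarrow> norm (mu_hat \<alpha>1 \<alpha>2 c d \<phi> \<xi>1 \<xi>2) \<le> B * norm \<xi>2 powr (- \<alpha> / m)"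
  proof (rule dyadic_bootstrap[where S = S and C = C, rotated 4])
    show "norm (mu_hat \<alpha>1 \<alpha>2 c d \<phi> \<xi>1 \<xi>2) \<le> measure lborel {x \<in> V. fst x < 1}" for \<xi>1 \<xi>2
      unfolding mu by (rule norm_set_integral_osc_le[OF c\<phi>V Vr box]) auto
    fix \<xi>1 \<xi>2 :: "real \<times> real" assume "\<xi>2 \<noteq> 0"
    from C(2)[OF this, of \<xi>1]
    have "norm (mu_hat \<alpha>1 \<alpha>2 c d \<phi> \<xi>1 \<xi>2) \<le> C * norm \<xi>2 powr (- 1 / real (p - 1))
        + norm ((h1 * h2) *\<^sub>R mu_hat \<alpha>1 \<alpha>2 c d \<phi> (S \<xi>1) (2 powr (- m) *\<^sub>R \<xi>2))"
      unfolding split[of \<xi>1 \<xi>2] inner by (rule order_trans[OF norm_triangle_ineq add_right_mono])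
    moreover have "h1 * h2 = 2 powr (- \<alpha>)" by (simp add: h1_def h2_def \<alpha>_def powr_add[symmetric])
    ultimately show "norm (mu_hat \<alpha>1 \<alpha>2 c d \<phi> \<xi>1 \<xi>2) \<le> C * norm \<xi>2 powr (- (1 / real (p - 1)))
        + 2 powr (- \<alpha>) * norm (mu_hat \<alpha>1 \<alpha>2 c d \<phi> (S \<xi>1) (2 powr (- m) *\<^sub>R \<xi>2))"
      by simp
  qed (use C m \<alpha> in auto)
  then show ?thesis by (simp add: \<alpha>_def)
qed

end
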